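(* Let $n,r$ be integers with $n>r\geq 2$, let $K$ be a field, let $S=K[x_1,\ldots,x_{n+r-1}]$ and let $I_{n,r}=x_1x_2\cdots x_{r-1}(x_r,x_{r+1},\ldots,x_{r+n-1})\subset S$. Then $$\operatorname{hdepth}(S/I_{n,r})\leq n+r-\left\lfloor \frac{n-r-1}{3}\right\rfloor-3.$$
   Context: $S$ carries the standard grading. For a finitely generated graded $S$-module $M$, the Hilbert depth $\operatorname{hdepth}(M)$ is the maximal depth of a finitely generated graded $S$-module $U$ having the same Hilbert series as $M$. The ideal $I_{n,r}$ is the squarefree monomial ideal generated by the $n$ monomials $x_1\cdots x_{r-1}x_{i}$, $r\leq i\leq r+n-1$. *)

theory Defs
  imports
    Jordan_Normal_Form.VS_Connect
    "HOL-Algebra.QuotRing"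
    "HOL-Library.Poly_Mapping"
    "HOL-Library.Extended_Nat"
begin

text \<open>A polynomial is a finitely supported map from monomials to coefficients, a monomial being a
  finitely supported map from variable indices to exponents. The type has infinitely many
  variables; the ring \<open>K[x\<^sub>1,\<dots>,x\<^sub>N]\<close> is cut out by its carrier.\<close>

type_synonym 'k polynomial = "(nat \<Rightarrow>\<^sub>0 nat) \<Rightarrow>\<^sub>0 'k"

definition X :: "nat \<Rightarrow> 'k::field polynomial"
  where "X i = Poly_Mapping.single (Poly_Mapping.single i 1) 1"

definition const :: "'k::field \<Rightarrow> 'k polynomial"
  where "const c = Poly_Mapping.single 0 c"

definition poly_ring :: "nat \<Rightarrow> 'k::field polynomial ring"
  where "poly_ring N =
    \<lparr>carrier = {p. \<forall>m\<in>Poly_Mapping.keys p. Poly_Mapping.keys m \<subseteq> {1..N}},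
     mult = (*), one = 1, zero = 0, add = (+)\<rparr>"

definition mon_deg :: "(nat \<Rightarrow>\<^sub>0 nat) \<Rightarrow> nat"
  where "mon_deg m = (\<Sum>i\<in>Poly_Mapping.keys m. Poly_Mapping.lookup m i)"

definition homogeneous :: "nat \<Rightarrow> int \<Rightarrow> 'k::field polynomial set"
  where "homogeneous N d =
    {p \<in> carrier (poly_ring N). \<forall>m\<in>Poly_Mapping.keys p. int (mon_deg m) = d}"

definition irrelevant_ideal :: "nat \<Rightarrow> 'k::field polynomial set"
  where "irrelevant_ideal N = genideal (poly_ring N) (X ` {1..N})"


text \<open>Only the fields \<open>carrier\<close>, \<open>zero\<close>, \<open>add\<close> and \<open>smult\<close> of a HOL-Algebra module record carry
  meaning; \<open>mult\<close> and \<open>one\<close> are inherited from the ring record. The additional field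
  \<open>component\<close> is the grading, indexed by all integers.\<close>

record ('a, 'b) graded_module = "('a, 'b) module" +
  component :: "int \<Rightarrow> 'b set"

definition is_graded_module :: "nat \<Rightarrow> ('k::field polynomial, 'b) graded_module \<Rightarrow> bool"
  where "is_graded_module N M \<longleftrightarrow>
    Module.module (poly_ring N) M \<and>
    (\<forall>i. additive_subgroup (component M i) M) \<and>
    (\<forall>i j. \<forall>p\<in>homogeneous N i. \<forall>u\<in>component M j. p \<odot>\<^bsub>M\<^esub> u \<in> component M (i + j)) \<and>
    (\<forall>u\<in>carrier M. \<exists>!c. (\<forall>i. c i \<in> component M i) \<and> finite {i. c i \<noteq> \<zero>\<^bsub>M\<^esub>} \<and>
        u = finsum M c {i. c i \<noteq> \<zero>\<^bsub>M\<^esub>})"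

definition finitely_generated :: "nat \<Rightarrow> ('k::field polynomial, 'b) graded_module \<Rightarrow> bool"
  where "finitely_generated N M \<longleftrightarrow>
    (\<exists>A. finite A \<and> A \<subseteq> carrier M \<and> LinearCombinations.module.span (poly_ring N) M A = carrier M)"

definition component_space ::
    "('k::field polynomial, 'b) graded_module \<Rightarrow> int \<Rightarrow> ('k, 'b) module"
  where "component_space M i =
    \<lparr>carrier = component M i, mult = mult M, one = one M, zero = zero M, add = add M,
     smult = (\<lambda>c u. const c \<odot>\<^bsub>M\<^esub> u)\<rparr>"

text \<open>The Hilbert series \<open>\<Sum>\<^sub>i dim\<^sub>K(M\<^sub>i) t\<^sup>i\<close>, as the family of its coefficients. For a finitely
  generated module all these dimensions are finite, so that \<open>vectorspace.dim\<close> is meaningful.\<close>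

definition hilbert_series :: "('k::field polynomial, 'b) graded_module \<Rightarrow> int \<Rightarrow> nat"
  where "hilbert_series M i = vectorspace.dim (class_ring :: 'k ring) (component_space M i)"


text \<open>The submodule \<open>(f\<^sub>1,\<dots>,f\<^sub>k)M\<close>.\<close>

definition seq_submodule ::
    "nat \<Rightarrow> ('k::field polynomial, 'b) graded_module \<Rightarrow> 'k polynomial list \<Rightarrow> 'b set"
  where "seq_submodule N M fs =
    LinearCombinations.module.span (poly_ring N) M {f \<odot>\<^bsub>M\<^esub> u | f u. f \<in> set fs \<and> u \<in> carrier M}"

definition regular_sequence ::
    "nat \<Rightarrow> ('k::field polynomial, 'b) graded_module \<Rightarrow> 'k polynomial list \<Rightarrow> bool"
  where "regular_sequence N M fs \<longleftrightarrow>
    set fs \<subseteq> carrier (poly_ring N) \<and>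
    (\<forall>i<length fs. \<forall>u\<in>carrier M.
       fs ! i \<odot>\<^bsub>M\<^esub> u \<in> seq_submodule N M (take i fs) \<longrightarrow> u \<in> seq_submodule N M (take i fs)) \<and>
    seq_submodule N M fs \<noteq> carrier M"

text \<open>The depth is the largest length of a regular sequence contained in the irrelevant ideal; the
  elements of the sequence need not be homogeneous. A nonzero finitely generated module
  has depth at most \<open>N\<close>, so the supremum is a maximum. (The zero module gets depth \<open>0\<close>.)\<close>

definition depth :: "nat \<Rightarrow> ('k::field polynomial, 'b) graded_module \<Rightarrow> enat"
  where "depth N M =
    Sup {enat (length fs) | fs. set fs \<subseteq> irrelevant_ideal N \<and> regular_sequence N M fs}"

text \<open>The module \<open>U\<close> ranges over all finitely generated graded modules up to isomorphism: such a
  module has at most \<open>max |K| \<aleph>\<^sub>0\<close> elements, so it is isomorphic to one whose carrier is a subset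
  of the type \<^typ>\<open>nat \<Rightarrow> 'k\<close>.\<close>

definition hdepth :: "nat \<Rightarrow> ('k::field polynomial, 'b) graded_module \<Rightarrow> enat"
  where "hdepth N M =
    Sup {depth N U | U :: ('k polynomial, nat \<Rightarrow> 'k) graded_module.
      is_graded_module N U \<and> finitely_generated N U \<and> hilbert_series U = hilbert_series M}"


definition quotient_module ::
    "nat \<Rightarrow> 'k::field polynomial set \<Rightarrow> ('k polynomial, 'k polynomial set) graded_module"
  where "quotient_module N I = (let S = poly_ring N; Q = S Quot I in
    \<lparr>carrier = carrier Q, mult = mult Q, one = one Q, zero = zero Q, add = add Q,
     smult = (\<lambda>p C. (I +>\<^bsub>S\<^esub> p) \<otimes>\<^bsub>Q\<^esub> C),
     component = (\<lambda>i. (\<lambda>p. I +>\<^bsub>S\<^esub> p) ` homogeneous N i)\<rparr>)"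

definition I_ideal :: "nat \<Rightarrow> nat \<Rightarrow> 'k::field polynomial set"
  where "I_ideal n r =
    genideal (poly_ring (n + r - 1)) {(\<Prod>j\<in>{1..r - 1}. X j) * X i | i. r \<le> i \<and> i \<le> r + n - 1}"

end

theory Submission
  imports
    Defs
    "HOL-Real_Asymp.Real_Asymp"
begin

text \<open>If \<open>U\<close> has a regular sequence of length \<open>d\<close>, then \<open>(1 - T)\<^sup>d\<close> times the Hilbert series of
  \<open>U\<close> has nonnegative coefficients. This is usually seen by dividing out generic linear forms, which
  needs an infinite field and prime avoidance. Here the generic form \<open>l = \<Sum>\<^sub>i x\<^sub>i t\<^sup>i\<^sup>-\<^sup>1\<close> with an auxiliary
  variable \<open>t\<close> is used instead: by McCoy's argument, it is a nonzerodivisor on \<open>U[t]\<close> as soon as no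
  nonzero element of \<open>U\<close> is killed by all the \<open>x\<^sub>i\<close>. If \<open>f\<^sub>1,\<dots>,f\<^sub>d\<close> is regular on \<open>U\<close>, then \<open>l\<close> is
  regular on each \<open>(U/(f\<^sub>1,\<dots>,f\<^sub>i)U)[t]\<close>, \<open>i < d\<close>, and therefore \<open>f\<^sub>1,\<dots>,f\<^sub>d\<^sub>-\<^sub>1\<close> is regular on the cokernel
  of \<open>l\<close>. Truncating by the degree in \<open>t\<close> keeps everything finite-dimensional: the cokernel of \<open>l\<close>
  from \<open>t\<close>-degree \<open>< a\<close> to \<open>t\<close>-degree \<open>< b = a + N - 1\<close> has Hilbert function
  \<open>b h(i) - a h(i - 1)\<close>. Iterating \<open>d\<close> times, dividing by \<open>b\<^sup>d\<close> and letting \<open>a\<close> tend to infinity gives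
  the claim.

  For \<open>S/I\<^sub>n\<^sub>,\<^sub>r\<close>, with \<open>q = \<lfloor>(n - r - 1)/3\<rfloor>\<close> and \<open>d\<close> one more than the asserted bound, the coefficient of
  \<open>T\<^sup>r\<^sup>-\<^sup>1\<^sup>+\<^sup>k\<close> is \<open>C(r-1+k+q, q) - C(k+q, q) + (-1)\<^sup>k C(n-1-q, k)\<close>, which is negative for \<open>k\<close> the odd
  one among \<open>q\<close> and \<open>q + 1\<close>.\<close>

section \<open>Dimensions of subspaces\<close>

locale linear_space = vector_space scale
  for scale :: "'k::field \<Rightarrow> 'b::ab_group_add \<Rightarrow> 'b"
begin

text \<open>An infinite-dimensional space gets \<open>dim\<close> equal to 0, so the dimension
  counts below have to carry finiteness explicitly.\<close>

definition findim :: "'b set \<Rightarrow> bool"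
  where "findim V \<longleftrightarrow> (\<exists>B. finite B \<and> V \<subseteq> span B)"

lemma findim_subset: "findim V \<Longrightarrow> U \<subseteq> V \<Longrightarrow> findim U"
  unfolding findim_def by blast

lemma findim_basis:
  assumes "findim V" "subspace V"
  obtains C where "finite C" "independent C" "C \<subseteq> V" "span C = V" "card C = dim V"
proof -
  obtain F where F: "finite F" "V \<subseteq> span F" using assms(1) by (auto simp: findim_def)
  obtain C where C: "C \<subseteq> V" "independent C" "V \<subseteq> span C" "card C = dim V"
    using basis_exists[of V] by blast
  have "finite C" using independent_span_bound[OF F(1) C(2)] C(1) F(2) by blast
  moreover have "span C = V" using C(1,3) span_minimal[OF C(1) assms(2)] by blast
  ultimately show ?thesis using that C by blast
qed

lemma findim_basis_extend:
  assumes "findim V" "subspace V" "independent C0" "C0 \<subseteq> V"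
  obtains C where "C0 \<subseteq> C" "finite C" "independent C" "C \<subseteq> V" "span C = V" "card C = dim V"
proof -
  obtain F where F: "finite F" "V \<subseteq> span F" using assms(1) by (auto simp: findim_def)
  obtain C where C: "C0 \<subseteq> C" "C \<subseteq> V" "independent C" "V \<subseteq> span C"
    using maximal_independent_subset_extend[OF assms(4,3)] by blast
  have "finite C" using independent_span_bound[OF F(1) C(3)] C(2) F(2) by blast
  moreover have "span C = V" using C(2,4) span_minimal[OF C(2) assms(2)] by blast
  moreover have "card C = dim V" using C by (intro basis_card_eq_dim) auto
  ultimately show ?thesis using that C by blast
qed

lemma findim_dim_mono:
  assumes "findim V" "subspace V" "subspace U" "U \<subseteq> V"
  shows "dim U \<le> dim V"
proof -
  obtain C0 where C0: "finite C0" "independent C0" "C0 \<subseteq> U" "card C0 = dim U"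
    using findim_basis[OF findim_subset[OF assms(1,4)] assms(3)] by metis
  obtain C where "C0 \<subseteq> C" "finite C" "card C = dim V"
    using findim_basis_extend[OF assms(1,2) C0(2)] C0(3) assms(4) by (metis order_trans)
  then show ?thesis using C0(4) card_mono by metis
qed

text \<open>The hypothesis \<open>inj\<close> makes \<open>f\<close> injective from the quotient by
  \<open>span C\<close> to the quotient by \<open>span D\<close>. Adding the vectors of
  \<open>G\<close> one at a time, a dependence of \<open>f g\<close> on the earlier images pulls
  back to one of \<open>g\<close> on \<open>C\<close> and the earlier vectors.\<close>

lemma independent_Un_image:
  assumes lin: "Vector_Spaces.linear scale scale f" and "finite G" "independent (C \<union> G)" "C \<inter> G = {}"
    and "independent D" "finite D" and inj: "\<forall>x\<in>span (C \<union> G). f x \<in> span D \<longrightarrow> x \<in> span C"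
  shows "independent (D \<union> f ` G) \<and> card (D \<union> f ` G) = card D + card G"
  using assms(2-)
proof (induction G rule: finite_induct)
  case empty
  then show ?case by simp
next
  interpret f: Vector_Spaces.linear scale scale f by (fact lin)
  interpret vp: vector_space_pair scale scale by unfold_locales
  case (insert g G)
  have sub: "span (C \<union> G) \<subseteq> span (C \<union> insert g G)" by (intro span_mono) auto
  have IH: "independent (D \<union> f ` G)" "card (D \<union> f ` G) = card D + card G"
    using insert.IH insert.prems sub independent_mono[of "C \<union> insert g G" "C \<union> G"] by auto
  have "f g \<notin> span (D \<union> f ` G)"
  proof
    assume "f g \<in> span (D \<union> f ` G)"
    then obtain d y where dy: "d \<in> span D" "y \<in> span (f ` G)" "f g = d + y"
      unfolding span_Un by blast
    then obtain x where x: "x \<in> span G" "y = f x"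
      using vp.linear_span_image[OF lin, of G] by auto
    have "f (g - x) = d" using dy(3) x(2) by (simp add: f.diff)
    moreover have "g - x \<in> span (C \<union> insert g G)"
      using x(1) span_mono[of G "C \<union> insert g G"] by (intro span_diff) (auto intro: span_base)
    ultimately have "g - x \<in> span C" using insert.prems dy(1) by blast
    then have "g - x + x \<in> span (C \<union> G)"
      using x(1) span_mono[of G "C \<union> G"] span_mono[of C "C \<union> G"] by (intro span_add) blast+
    then have "g \<in> span (C \<union> G)" by simp
    moreover have "C \<union> insert g G - {g} = C \<union> G" using insert by auto
    ultimately show False using insert.prems(1) unfolding dependent_def by auto
  qed
  moreover from this have "f g \<notin> D \<union> f ` G" by (auto intro: span_base)
  ultimately show ?case using IH insert.hyps insert.prems by (auto simp: independent_insertI)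
qed

text \<open>By \<open>pre\<close>, \<open>f\<close> embeds \<open>A/A1\<close> into the ambient
  space modulo \<open>B\<close>, so the sum \<open>B + f(A)\<close> gains exactly dim
  \<open>A/A1\<close> over \<open>B\<close>. The identity is written as a sum to avoid natural
  subtraction.\<close>

lemma dim_add_image:
  assumes lin: "Vector_Spaces.linear scale scale f"
    and A: "findim A" "subspace A" and A1: "subspace A1" "A1 \<subseteq> A"
    and B: "findim B" "subspace B" and pre: "\<And>x. x \<in> A \<Longrightarrow> f x \<in> B \<longleftrightarrow> x \<in> A1"
  shows "findim {b + f a | b a. b \<in> B \<and> a \<in> A}"
    and "dim {b + f a | b a. b \<in> B \<and> a \<in> A} + dim A1 = dim B + dim A"
proof -
  interpret f: Vector_Spaces.linear scale scale f by (fact lin)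
  interpret vp: vector_space_pair scale scale by unfold_locales
  let ?V = "{b + f a | b a. b \<in> B \<and> a \<in> A}"
  obtain C1 where C1: "finite C1" "independent C1" "C1 \<subseteq> A1" "span C1 = A1" "card C1 = dim A1"
    using findim_basis[OF findim_subset[OF A(1) A1(2)] A1(1)] by metis
  obtain C where C: "C1 \<subseteq> C" "finite C" "independent C" "C \<subseteq> A" "span C = A" "card C = dim A"
    using findim_basis_extend[OF A C1(2)] C1(3) A1(2) by (metis order_trans)
  obtain D where D: "finite D" "independent D" "D \<subseteq> B" "span D = B" "card D = dim B"
    using findim_basis[OF B] by metis
  \<comment> \<open>\<open>G\<close> represents a basis of \<open>A/A1\<close>. Since
    \<open>f\<close> sends the span of \<open>C1\<close> into \<open>B\<close>, only the images of
    \<open>G\<close> enlarge \<open>B\<close>.\<close>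
  define G where "G = C - C1"
  have CG: "C1 \<union> G = C" "C1 \<inter> G = {}" "finite G" using C(1,2) by (auto simp: G_def)
  have ind: "independent (D \<union> f ` G)" "card (D \<union> f ` G) = card D + card G"
    using independent_Un_image[OF lin, of G C1 D] CG C C1 D pre by auto
  have V: "?V = span (D \<union> f ` G)"
  proof
    show "?V \<subseteq> span (D \<union> f ` G)"
    proof
      fix v assume "v \<in> ?V"
      then obtain b a where v: "v = b + f a" "b \<in> B" "a \<in> A" by auto
      from v(3) obtain c g where a: "a = c + g" "c \<in> span C1" "g \<in> span G"
        using C(5) CG(1) span_Un[of C1 G] by force
      have "f c \<in> B" using a(2) C1(4) A1(2) pre by auto
      then have "b + f c \<in> span D" using v(2) B(2) D(4) by (simp add: subspace_add)
      moreover have "f g \<in> span (f ` G)" using a(3) vp.linear_span_image[OF lin, of G] by auto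
      moreover have "v = (b + f c) + f g" using v a by (simp add: f.add ac_simps)
      ultimately show "v \<in> span (D \<union> f ` G)" unfolding span_Un by blast
    qed
    show "span (D \<union> f ` G) \<subseteq> ?V"
    proof
      fix v assume "v \<in> span (D \<union> f ` G)"
      then obtain d y where "d \<in> B" "y \<in> span (f ` G)" "v = d + y"
        unfolding span_Un D(4) by blast
      moreover have "span G \<subseteq> A" using C(5) CG(1) by (metis span_mono Un_upper2)
      ultimately show "v \<in> ?V" using vp.linear_span_image[OF lin, of G] by auto
    qed
  qed
  have "finite (D \<union> f ` G)" using D(1) CG(3) by simp
  then show "findim ?V" unfolding findim_def using V by (intro exI[of _ "D \<union> f ` G"]) simp
  have "dim ?V = card D + card G" using V dim_span_eq_card_independent[OF ind(1)] ind(2) by simp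
  moreover have "card C = card C1 + card G" using CG C1(1) by (metis card_Un_disjoint)
  ultimately show "dim ?V + dim A1 = dim B + dim A" using C C1 D by linarith
qed

end

section \<open>Generic linear forms\<close>

text \<open>All modules are subquotients of one fixed type, so that the induction on the length of a regular
  sequence does not change types. The second index numbers the generators of the original module;
  the first one lists the exponents of the auxiliary variables \<open>t\<close> adjoined so far, newest first.\<close>

typedef (overloaded) ('k::field) array = "UNIV :: (nat list \<Rightarrow> nat \<Rightarrow> 'k polynomial) set"
  morphisms entry Array ..

lemma entry_Array [simp]: "entry (Array f) = f"
  by (simp add: Array_inverse)

lemma array_ext: "(\<And>xs k. entry e xs k = entry e' xs k) \<Longrightarrow> e = e'"
  by (metis ext entry_inject)

instantiation array :: (field) ab_group_add
begin

definition "0 = Array (\<lambda>xs k. 0)"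
definition "e + e' = Array (\<lambda>xs k. entry e xs k + entry e' xs k)"
definition "e - e' = Array (\<lambda>xs k. entry e xs k - entry e' xs k)"
definition "- e = Array (\<lambda>xs k. - entry e xs k)"

instance
  by standard
    (auto intro!: array_ext
      simp: zero_array_def plus_array_def minus_array_def uminus_array_def ac_simps)

end

lemma entry_simps [simp]:
  "entry 0 xs k = 0" "entry (e + e') xs k = entry e xs k + entry e' xs k"
  "entry (e - e') xs k = entry e xs k - entry e' xs k" "entry (- e) xs k = - entry e xs k"
  by (simp_all add: zero_array_def plus_array_def minus_array_def uminus_array_def)

definition act :: "'k::field polynomial \<Rightarrow> 'k array \<Rightarrow> 'k array"
  where "act p e = Array (\<lambda>xs k. p * entry e xs k)"

lemma entry_act [simp]: "entry (act p e) xs k = p * entry e xs k"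
  by (simp add: act_def)

lemma act_simps [simp]:
  "act p (e + e') = act p e + act p e'" "act p (e - e') = act p e - act p e'"
  "act p 0 = 0" "act 0 e = 0" "act 1 e = e" "act p (- e) = - act p e" "act (- 1) e = - e"
  by (auto intro!: array_ext simp: distrib_left right_diff_distrib)

lemma act_add_left: "act (p + q) e = act p e + act q e"
  by (auto intro!: array_ext simp: distrib_right)

lemma act_act: "act p (act q e) = act (p * q) e"
  by (auto intro!: array_ext simp: mult.assoc)

lemma act_commute: "act p (act q e) = act q (act p e)"
  by (auto intro!: array_ext simp: mult.left_commute)

lemma act_sum: "act p (\<Sum>i\<in>I. f i) = (\<Sum>i\<in>I. act p (f i))"
  by (induction I rule: infinite_finite_induct) simp_all

section \<open>The polynomial ring and its submodules of arrays\<close>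

lemma carrier_poly_ring: "p \<in> carrier (poly_ring N) \<longleftrightarrow> (\<forall>m\<in>Poly_Mapping.keys p. Poly_Mapping.keys m \<subseteq> {1..N})"
  by (simp add: poly_ring_def)

lemma poly_ring_simps [simp]: "Group.monoid.mult (poly_ring N) = (*)" "Group.monoid.one (poly_ring N) = 1"
  "Ring.ring.zero (poly_ring N) = 0" "Ring.ring.add (poly_ring N) = (+)"
  by (auto simp: poly_ring_def)

lemma keys_subset_add:
  "Poly_Mapping.keys m \<subseteq> V \<Longrightarrow> Poly_Mapping.keys n \<subseteq> V \<Longrightarrow> Poly_Mapping.keys (m + n) \<subseteq> V"
  using Poly_Mapping.keys_add[of m n] by blast

lemma poly_ring_closed [simp, intro]:
  "0 \<in> carrier (poly_ring N)" "1 \<in> carrier (poly_ring N)" "const c \<in> carrier (poly_ring N)"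
  "i \<in> {1..N} \<Longrightarrow> X i \<in> carrier (poly_ring N)"
  "p \<in> carrier (poly_ring N) \<Longrightarrow> q \<in> carrier (poly_ring N) \<Longrightarrow> p + q \<in> carrier (poly_ring N)"
  "p \<in> carrier (poly_ring N) \<Longrightarrow> q \<in> carrier (poly_ring N) \<Longrightarrow> p * q \<in> carrier (poly_ring N)"
  "p \<in> carrier (poly_ring N) \<Longrightarrow> - p \<in> carrier (poly_ring N)"
proof -
  show "p \<in> carrier (poly_ring N) \<Longrightarrow> q \<in> carrier (poly_ring N) \<Longrightarrow> p + q \<in> carrier (poly_ring N)"
    using Poly_Mapping.keys_add[of p q] by (auto simp: carrier_poly_ring)
  show "p * q \<in> carrier (poly_ring N)" if "p \<in> carrier (poly_ring N)" "q \<in> carrier (poly_ring N)"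
    unfolding carrier_poly_ring
  proof
    fix m assume "m \<in> Poly_Mapping.keys (p * q)"
    then obtain m1 m2 where "m = m1 + m2" "m1 \<in> Poly_Mapping.keys p" "m2 \<in> Poly_Mapping.keys q"
      using keys_mult[of p q] by auto
    then show "Poly_Mapping.keys m \<subseteq> {1..N}"
      using that keys_subset_add[of m1 "{1..N}" m2] by (simp add: carrier_poly_ring)
  qed
qed (auto simp: carrier_poly_ring const_def X_def)

lemma const_simps: "const (a + b) = const a + const b" "const (a * b) = const a * const b"
    "const 0 = 0" "const 1 = 1"
  by (auto simp: const_def single_add mult_single)

interpretation arr: linear_space "\<lambda>c. act (const c)"
  by unfold_locales (auto simp: act_add_left act_act const_simps)

definition submod :: "nat \<Rightarrow> 'k::field array set \<Rightarrow> bool"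
  where "submod N V \<longleftrightarrow> 0 \<in> V \<and> (\<forall>u\<in>V. \<forall>v\<in>V. u + v \<in> V) \<and>
    (\<forall>p\<in>carrier (poly_ring N). \<forall>u\<in>V. act p u \<in> V)"

lemma submodD:
  assumes "submod N V"
  shows "0 \<in> V" "u \<in> V \<Longrightarrow> v \<in> V \<Longrightarrow> u + v \<in> V" "u \<in> V \<Longrightarrow> v \<in> V \<Longrightarrow> u - v \<in> V"
    "p \<in> carrier (poly_ring N) \<Longrightarrow> u \<in> V \<Longrightarrow> act p u \<in> V"
proof -
  show "0 \<in> V" "u \<in> V \<Longrightarrow> v \<in> V \<Longrightarrow> u + v \<in> V"
    "p \<in> carrier (poly_ring N) \<Longrightarrow> u \<in> V \<Longrightarrow> act p u \<in> V" for u v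
    using assms by (auto simp: submod_def)
  then show "u \<in> V \<Longrightarrow> v \<in> V \<Longrightarrow> u - v \<in> V"
    using assms poly_ring_closed(7)[OF poly_ring_closed(2), of N]
    by (metis add_uminus_conv_diff submod_def act_simps(7))
qed

lemma submod_sum:
  assumes "submod N V" "\<And>i. i \<in> I \<Longrightarrow> f i \<in> V"
  shows "(\<Sum>i\<in>I. f i) \<in> V"
  using assms(2) by (induction I rule: infinite_finite_induct) (auto simp: submodD[OF assms(1)])

lemma submod_subspace: "submod N V \<Longrightarrow> arr.subspace V"
  by (auto simp: arr.subspace_def submod_def)

section \<open>Polynomials in a newly adjoined variable\<close>

definition slot :: "nat \<Rightarrow> 'k::field array \<Rightarrow> 'k array"
  where "slot j e = Array (\<lambda>xs. entry e (j # xs))"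

text \<open>\<open>slot j\<close> reads off the coefficient of \<open>t^j\<close> in the newest
  variable and never sees the entries at the empty list. Forcing these to vanish makes an array
  determined by its slots.\<close>

definition nil_free :: "'k::field array \<Rightarrow> bool"
  where "nil_free e \<longleftrightarrow> (\<forall>k. entry e [] k = 0)"

text \<open>The polynomials in a new variable of degree less than \<open>b\<close>, with coefficients in \<open>V\<close>.\<close>

definition pw :: "nat \<Rightarrow> 'k::field array set \<Rightarrow> 'k array set"
  where "pw b V = {e. nil_free e \<and> (\<forall>j<b. slot j e \<in> V) \<and> (\<forall>j\<ge>b. slot j e = 0)}"

lemma entry_slot [simp]: "entry (slot j e) xs k = entry e (j # xs) k"
  by (simp add: slot_def)

lemma slot_simps [simp]:
  "slot j (e + e') = slot j e + slot j e'" "slot j (e - e') = slot j e - slot j e'" "slot j 0 = 0"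
  "slot j (act p e) = act p (slot j e)"
  by (auto intro!: array_ext)

lemma nil_free_simps [simp]: "nil_free 0" "nil_free e \<Longrightarrow> nil_free e' \<Longrightarrow> nil_free (e + e')"
  "nil_free e \<Longrightarrow> nil_free e' \<Longrightarrow> nil_free (e - e')" "nil_free e \<Longrightarrow> nil_free (act p e)"
  by (auto simp: nil_free_def)

lemma array_eqI:
  assumes "nil_free e" "nil_free e'" "\<And>j. slot j e = slot j e'"
  shows "e = e'"
proof (rule array_ext)
  fix xs k show "entry e xs k = entry e' xs k"
    using assms(1,2) arg_cong[OF assms(3), of "\<lambda>u. entry u (tl xs) k" "hd xs"]
    by (cases xs) (auto simp: nil_free_def)
qed

definition mk_array :: "(nat \<Rightarrow> 'k::field array) \<Rightarrow> 'k array"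
  where "mk_array g = Array (\<lambda>xs k. case xs of [] \<Rightarrow> 0 | j # ys \<Rightarrow> entry (g j) ys k)"

lemma mk_array_simps [simp]: "nil_free (mk_array g)" "slot j (mk_array g) = g j"
  by (auto simp: mk_array_def nil_free_def intro!: array_ext)

lemma slot_in: "e \<in> pw b V \<Longrightarrow> 0 \<in> V \<Longrightarrow> slot j e \<in> V"
  by (cases "j < b") (auto simp: pw_def)

lemma submod_pw: "submod N V \<Longrightarrow> submod N (pw b V)"
  by (auto simp: submod_def pw_def)

lemma pw_mono: "U \<subseteq> V \<Longrightarrow> pw b U \<subseteq> pw b V"
  by (auto simp: pw_def)

text \<open>The coefficient of \<open>t\<^sup>j\<close> in the product of \<open>\<Sum>\<^sub>i X\<^sub>i t\<^sup>i\<^sup>-\<^sup>1\<close> and \<open>\<Sum>\<^sub>j g\<^sub>j t\<^sup>j\<close>.\<close>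

definition conv :: "nat \<Rightarrow> (nat \<Rightarrow> 'k::field array) \<Rightarrow> nat \<Rightarrow> 'k array"
  where "conv N g j = (\<Sum>i\<in>{1..N}. if i \<le> Suc j then act (X i) (g (Suc j - i)) else 0)"

lemma conv_add: "conv N (\<lambda>j. f j + g j) j = conv N f j + conv N g j"
  unfolding conv_def sum.distrib[symmetric] by (rule sum.cong) auto

lemma conv_diff: "conv N (\<lambda>j. f j - g j) j = conv N f j - conv N g j"
  unfolding conv_def sum_subtractf[symmetric] by (rule sum.cong) auto

lemma conv_act: "conv N (\<lambda>j. act p (g j)) j = act p (conv N g j)"
  unfolding conv_def act_sum by (rule sum.cong) (auto simp: act_commute)

lemma conv_in:
  assumes "submod N V" "\<And>j. g j \<in> V"
  shows "conv N g j \<in> V"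
  unfolding conv_def using assms by (intro submod_sum) (auto simp: submodD)

text \<open>Modulo \<open>W\<close>, comparing top coefficients shows, for \<open>i\<close> descending from \<open>N\<close>, that \<open>X\<^sub>i g\<close> has smaller
  degree than \<open>g\<close>; as it is again annihilated by the form, it vanishes by induction.\<close>

lemma mccoy:
  assumes W: "submod N W" and M: "submod N M"
    and soc: "\<And>u. u \<in> M \<Longrightarrow> \<forall>i\<in>{1..N}. act (X i) u \<in> W \<Longrightarrow> u \<in> W"
  shows "\<forall>j<a. g j \<in> M \<Longrightarrow> \<forall>j\<ge>a. g j = 0 \<Longrightarrow> \<forall>j. conv N g j \<in> W \<Longrightarrow> g j \<in> W"
proof (induction a arbitrary: g j)
  case 0
  then show ?case using submodD(1)[OF W] by (metis le0)
next
  case (Suc a)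
  have inM: "g j \<in> M" for j
    using Suc.prems submodD(1)[OF M] by (cases "j < Suc a") auto
  have key: "\<forall>j. act (X i) (g j) \<in> W" if "i \<in> {1..N}" for i
    using that
  proof (induction "N - i" arbitrary: i rule: less_induct)
    case less
    have IH: "act (X i') (g j) \<in> W" if "i' \<in> {1..N}" "i < i'" for i' j
      using less.hyps[of i'] that less.prems by auto
    \<comment> \<open>\<open>X i\<close> carries \<open>t^(i-1)\<close>, so
      \<open>act (X i) (g a)\<close> occurs in the coefficient of \<open>t^(a+i-1)\<close>. There
      the terms with larger index lie in \<open>W\<close> by induction, and those with smaller index
      involve coefficients of \<open>g\<close> beyond degree \<open>a\<close>, which are
      zero.\<close>
    let ?t = "\<lambda>i'. if i' \<le> Suc (a + i - 1) then act (X i') (g (Suc (a + i - 1) - i')) else 0"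
    have "?t i' \<in> W" if "i' \<in> {1..N} - {i}" for i'
    proof (cases "i < i'")
      case True
      then show ?thesis using IH that submodD(1)[OF W] by auto
    next
      case False
      then have "g (Suc (a + i - 1) - i') = 0" using that less.prems Suc.prems(2) by auto
      then show ?thesis using submodD(1)[OF W] by auto
    qed
    then have rest: "(\<Sum>i'\<in>{1..N} - {i}. ?t i') \<in> W" by (rule submod_sum[OF W])
    have "conv N g (a + i - 1) = ?t i + (\<Sum>i'\<in>{1..N} - {i}. ?t i')"
      unfolding conv_def using less.prems by (intro sum.remove) auto
    moreover have "?t i = act (X i) (g a)" using less.prems by (auto simp: Suc_diff_le)
    ultimately have "act (X i) (g a) = conv N g (a + i - 1) - (\<Sum>i'\<in>{1..N} - {i}. ?t i')"
      by (simp only: add_diff_cancel_right')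
    moreover have "conv N g (a + i - 1) - (\<Sum>i'\<in>{1..N} - {i}. ?t i') \<in> W"
      using Suc.prems(3) rest submodD(3)[OF W] by blast
    ultimately have top: "act (X i) (g a) \<in> W" by (simp only:)
    \<comment> \<open>The top coefficient of \<open>X i\<close> times \<open>g\<close> is only known
      to lie in \<open>W\<close>. Subtracting it makes the coefficient literally zero, as the
      induction on \<open>a\<close> demands.\<close>
    define r where "r j = (if j = a then act (X i) (g a) else 0)" for j
    define g' where "g' j = act (X i) (g j) - r j" for j
    have rW: "r j \<in> W" for j using top submodD(1)[OF W] by (auto simp: r_def)
    have "conv N g' j \<in> W" for j
    proof -
      have "act (X i) (conv N g j) \<in> W"
        using submodD(4)[OF W poly_ring_closed(4)[OF less.prems]] Suc.prems(3) by blast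
      from submodD(3)[OF W this conv_in[OF W rW]] show ?thesis
        unfolding g'_def conv_diff conv_act .
    qed
    moreover have "\<forall>j<a. g' j \<in> M" using inM less.prems by (auto simp: g'_def r_def submodD[OF M])
    moreover have "\<forall>j\<ge>a. g' j = 0" using Suc.prems(2) by (auto simp: g'_def r_def)
    ultimately have "g' j \<in> W" for j using Suc.IH by blast
    then have "g' j + r j \<in> W" for j using rW submodD(2)[OF W] by blast
    then show ?case by (simp add: g'_def)
  qed
  then show ?case using soc[OF inM] by blast
qed

text \<open>Multiplication by the generic linear form, written in the newest variable
  \<open>t\<close>.\<close>

definition ell :: "nat \<Rightarrow> 'k::field array \<Rightarrow> 'k array"
  where "ell N e = mk_array (conv N (\<lambda>j. slot j e))"

lemma ell_simps [simp]: "nil_free (ell N e)" "slot j (ell N e) = conv N (\<lambda>j. slot j e) j"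
  by (auto simp: ell_def)

lemma ell_add: "ell N (e + e') = ell N e + ell N e'"
  by (rule array_eqI) (auto simp: conv_add)

lemma ell_diff: "ell N (e - e') = ell N e - ell N e'"
  by (rule array_eqI) (auto simp: conv_diff)

lemma ell_act: "ell N (act p e) = act p (ell N e)"
  by (rule array_eqI) (auto simp: conv_act)

text \<open>The generic form has degree \<open>N - 1\<close> in \<open>t\<close>, which accounts for
  the growth of the truncation bound.\<close>

lemma ell_pw:
  assumes "submod N V" "e \<in> pw a V" "N \<ge> 1"
  shows "ell N e \<in> pw (a + N - 1) V"
proof -
  have "slot j e \<in> V" for j using assms(2) submodD(1)[OF assms(1)] by (rule slot_in)
  then have "slot j (ell N e) \<in> V" for j using conv_in[OF assms(1)] by simp
  moreover have "slot j (ell N e) = 0" if "a + N - 1 \<le> j" for j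
    using that assms(2,3) by (auto simp: conv_def pw_def intro!: sum.neutral)
  ultimately show ?thesis by (auto simp: pw_def)
qed

text \<open>By \<open>soc\<close>, no nonzero class of \<open>M/W\<close> is killed by all
  variables. McCoy's argument, applied to the slots, then makes the generic form a nonzerodivisor on
  polynomials over \<open>M/W\<close>.\<close>

lemma ell_mccoy:
  assumes W: "submod N W" and M: "submod N M"
    and soc: "\<And>u. u \<in> M \<Longrightarrow> \<forall>i\<in>{1..N}. act (X i) u \<in> W \<Longrightarrow> u \<in> W"
    and v: "v \<in> pw a M" "ell N v \<in> pw b W"
  shows "v \<in> pw a W"
proof -
  have "conv N (\<lambda>j. slot j v) j \<in> W" for j
    using slot_in[OF v(2) submodD(1)[OF W], of j] by simp
  then have "slot j v \<in> W" for j
    using mccoy[OF W M soc, of a "\<lambda>j. slot j v" j] v(1) by (auto simp: pw_def)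
  then show ?thesis using v(1) by (auto simp: pw_def)
qed

section \<open>Relations of quotients by ring elements and of cokernels of the generic form\<close>

definition add_act :: "'k::field array set \<Rightarrow> 'k polynomial \<Rightarrow> 'k array set \<Rightarrow> 'k array set"
  where "add_act W f M = {w + act f u | w u. w \<in> W \<and> u \<in> M}"

text \<open>Applied to the truncations \<open>pw b W\<close> and \<open>pw a M\<close>, this gives
  the relations of the cokernel of the generic form from \<open>t\<close>-degree below
  \<open>a\<close> to \<open>t\<close>-degree below \<open>b\<close>.\<close>

definition add_ell :: "nat \<Rightarrow> 'k::field array set \<Rightarrow> 'k array set \<Rightarrow> 'k array set"
  where "add_ell N W M = {w + ell N u | w u. w \<in> W \<and> u \<in> M}"

text \<open>Regularity on \<open>M/W\<close>, without the condition that the last quotient is nonzero.\<close>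

fun weakly_regular :: "'k::field array set \<Rightarrow> 'k array set \<Rightarrow> 'k polynomial list \<Rightarrow> bool" where
  "weakly_regular M W [] \<longleftrightarrow> True"
| "weakly_regular M W (f # fs) \<longleftrightarrow> (\<forall>u\<in>M. act f u \<in> W \<longrightarrow> u \<in> W) \<and> weakly_regular M (add_act W f M) fs"

lemma submod_add_act:
  fixes W M :: "'a::field array set"
  assumes "submod N W" "submod N M" "f \<in> carrier (poly_ring N)"
  shows "submod N (add_act W f M)"
  unfolding submod_def
proof (intro conjI ballI)
  show "0 \<in> add_act W f M"
    unfolding add_act_def using submodD(1)[OF assms(1)] submodD(1)[OF assms(2)]
    by (intro CollectI exI[of _ 0]) simp
  fix u v assume "u \<in> add_act W f M" "v \<in> add_act W f M"
  then obtain w x w' x' where "u = w + act f x" "v = w' + act f x'" "w \<in> W" "x \<in> M" "w' \<in> W" "x' \<in> M"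
    by (auto simp: add_act_def)
  moreover from this have "u + v = (w + w') + act f (x + x')" by simp
  ultimately show "u + v \<in> add_act W f M"
    unfolding add_act_def using submodD(2)[OF assms(1)] submodD(2)[OF assms(2)] by blast
next
  fix p :: "'a polynomial" and u assume "p \<in> carrier (poly_ring N)" "u \<in> add_act W f M"
  then obtain w x where "u = w + act f x" "w \<in> W" "x \<in> M" by (auto simp: add_act_def)
  moreover from this have "act p u = act p w + act f (act p x)" by (simp add: act_commute)
  ultimately show "act p u \<in> add_act W f M"
    unfolding add_act_def using submodD(4)[OF assms(1)] submodD(4)[OF assms(2)] \<open>p \<in> _\<close> by blast
qed

lemma submod_add_ell:
  fixes W M :: "'a::field array set"
  assumes "submod N W" "submod N M"
  shows "submod N (add_ell N W M)"
  unfolding submod_def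
proof (intro conjI ballI)
  have "ell N 0 = 0" using ell_diff[of N 0 0] by simp
  then show "0 \<in> add_ell N W M"
    unfolding add_ell_def using submodD(1)[OF assms(1)] submodD(1)[OF assms(2)]
    by (intro CollectI exI[of _ 0]) simp
  fix u v assume "u \<in> add_ell N W M" "v \<in> add_ell N W M"
  then obtain w x w' x' where "u = w + ell N x" "v = w' + ell N x'" "w \<in> W" "x \<in> M" "w' \<in> W" "x' \<in> M"
    by (auto simp: add_ell_def)
  moreover from this have "u + v = (w + w') + ell N (x + x')" by (simp add: ell_add)
  ultimately show "u + v \<in> add_ell N W M"
    unfolding add_ell_def using submodD(2)[OF assms(1)] submodD(2)[OF assms(2)] by blast
next
  fix p :: "'a polynomial" and u assume "p \<in> carrier (poly_ring N)" "u \<in> add_ell N W M"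
  then obtain w x where "u = w + ell N x" "w \<in> W" "x \<in> M" by (auto simp: add_ell_def)
  moreover from this have "act p u = act p w + ell N (act p x)" by (simp add: ell_act)
  ultimately show "act p u \<in> add_ell N W M"
    unfolding add_ell_def using submodD(4)[OF assms(1)] submodD(4)[OF assms(2)] \<open>p \<in> _\<close> by blast
qed

text \<open>Multiplication by \<open>f\<close> acts on each coefficient separately, so
  representatives chosen slot by slot can be assembled into two arrays.\<close>

lemma pw_add_act:
  assumes "0 \<in> W" "0 \<in> M"
  shows "pw b (add_act W f M) = add_act (pw b W) f (pw b M)"
proof
  show "add_act (pw b W) f (pw b M) \<subseteq> pw b (add_act W f M)"
  proof
    fix e assume "e \<in> add_act (pw b W) f (pw b M)"
    then obtain w u where e: "e = w + act f u" "w \<in> pw b W" "u \<in> pw b M" by (auto simp: add_act_def)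
    then show "e \<in> pw b (add_act W f M)"
      unfolding pw_def add_act_def by (simp, blast)
  qed
  show "pw b (add_act W f M) \<subseteq> add_act (pw b W) f (pw b M)"
  proof
    fix e assume e: "e \<in> pw b (add_act W f M)"
    then have "\<forall>j. \<exists>w u. j < b \<longrightarrow> slot j e = w + act f u \<and> w \<in> W \<and> u \<in> M"
      by (auto simp: pw_def add_act_def)
    then obtain w u where wu: "\<And>j. j < b \<Longrightarrow> slot j e = w j + act f (u j) \<and> w j \<in> W \<and> u j \<in> M"
      by metis
    define w' where "w' = mk_array (\<lambda>j. if j < b then w j else 0)"
    define u' where "u' = mk_array (\<lambda>j. if j < b then u j else 0)"
    have "e = w' + act f u'"
    proof (rule array_eqI)
      show "nil_free e" "nil_free (w' + act f u')" using e by (auto simp: w'_def u'_def pw_def)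
      show "slot j e = slot j (w' + act f u')" for j
        using e wu by (cases "j < b") (auto simp: w'_def u'_def pw_def)
    qed
    moreover have "w' \<in> pw b W" "u' \<in> pw b M" using wu by (auto simp: pw_def w'_def u'_def)
    ultimately show "e \<in> add_act (pw b W) f (pw b M)" unfolding add_act_def by blast
  qed
qed

lemma cring_poly_ring: "Ring.cring (poly_ring N :: 'k::field polynomial ring)"
proof (rule cringI)
  show "abelian_group (poly_ring N :: 'k polynomial ring)"
  proof (rule abelian_groupI)
    fix x :: "'k polynomial" assume "x \<in> carrier (poly_ring N)"
    then show "\<exists>y\<in>carrier (poly_ring N). y \<oplus>\<^bsub>poly_ring N\<^esub> x = \<zero>\<^bsub>poly_ring N\<^esub>"
      by (intro bexI[of _ "- x"]) auto
  qed (auto simp: ac_simps)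
  show "Group.comm_monoid (poly_ring N :: 'k polynomial ring)"
    by (rule comm_monoidI) (auto simp: ac_simps)
qed (auto simp: distrib_right)

interpretation pr: Ring.cring "poly_ring N :: 'k::field polynomial ring" for N
  by (rule cring_poly_ring)

text \<open>The polynomials carrying \<open>u\<close> into \<open>W\<close> form an ideal; once it
  contains the variables it contains the irrelevant ideal. Hence a single irrelevant nonzerodivisor
  on \<open>M/W\<close> yields the socle condition of \<open>ell_mccoy\<close>.\<close>

lemma irrelevant_act:
  fixes W :: "'a::field array set"
  assumes "f \<in> irrelevant_ideal N" "submod N W" "\<forall>i\<in>{1..N}. act (X i) u \<in> W"
  shows "f \<in> carrier (poly_ring N) \<and> act f u \<in> W"
proof -
  let ?J = "{p \<in> carrier (poly_ring N). act p u \<in> W}"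
  have "ideal ?J (poly_ring N)"
  proof (rule idealI)
    show "subgroup ?J (add_monoid (poly_ring N))"
    proof (rule pr.add.subgroupI)
      fix a :: "'a polynomial" assume "a \<in> ?J"
      then have "- a \<in> ?J"
        using submodD(4)[OF assms(2) poly_ring_closed(7)[OF poly_ring_closed(2)], of "act a u"]
        by (auto simp: act_act)
      moreover have "\<ominus>\<^bsub>poly_ring N\<^esub> a = - a"
        using \<open>a \<in> ?J\<close> by (intro pr.minus_equality) auto
      ultimately show "\<ominus>\<^bsub>poly_ring N\<^esub> a \<in> ?J" by simp
    next
      show "?J \<noteq> {}" using submodD(1)[OF assms(2)] by (auto intro!: exI[of _ 0])
    qed (auto simp: act_add_left submodD(2)[OF assms(2)])
  next
    fix a x :: "'a polynomial" assume "a \<in> ?J" "x \<in> carrier (poly_ring N)"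
    then show "x \<otimes>\<^bsub>poly_ring N\<^esub> a \<in> ?J"
      using submodD(4)[OF assms(2), of x "act a u"] by (auto simp: act_act)
    then show "a \<otimes>\<^bsub>poly_ring N\<^esub> x \<in> ?J" by (simp add: mult.commute)
  qed (rule pr.ring_axioms)
  moreover have "X ` {1..N} \<subseteq> ?J" using assms(3) by auto
  ultimately have "irrelevant_ideal N \<subseteq> ?J"
    unfolding irrelevant_ideal_def by (rule pr.genideal_minimal)
  then show ?thesis using assms(1) by blast
qed

text \<open>An exchange argument: if \<open>f u\<close> is a multiple \<open>l v\<close> of the
  generic form modulo \<open>W\<close>, then \<open>l\<close> being regular modulo
  \<open>W + f M\<close> gives \<open>v = f v'\<close> up to \<open>W\<close>. Cancelling
  \<open>f\<close> shows that \<open>u\<close> is the multiple \<open>l v'\<close> modulo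
  \<open>W\<close>. Regularity of \<open>l\<close> after \<open>f\<close> comes from the next
  element of the sequence, so the last element is lost.\<close>

lemma weakly_regular_add_ell:
  fixes W M :: "'a::field array set"
  assumes "submod N M" "N \<ge> 1"
  shows "submod N W \<Longrightarrow> W \<subseteq> M \<Longrightarrow> fs \<noteq> [] \<Longrightarrow> set fs \<subseteq> irrelevant_ideal N \<Longrightarrow> weakly_regular M W fs \<Longrightarrow>
    weakly_regular (pw (a + N - 1) M) (add_ell N (pw (a + N - 1) W) (pw a M)) (butlast fs)"
proof (induction fs arbitrary: W)
  case Nil
  then show ?case by simp
next
  case (Cons f fs)
  show ?case
  proof (cases fs)
    case Nil
    then show ?thesis by simp
  next
    case (Cons f' fs')
    let ?b = "a + N - 1"
    note M = assms(1) and W = Cons.prems(1)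
    have f: "f \<in> carrier (poly_ring N)"
      using irrelevant_act[of f N UNIV 0] Cons.prems(4) by (auto simp: submod_def)
    define W1 where "W1 = add_act W f M"
    have W1: "submod N W1" unfolding W1_def using W M f by (rule submod_add_act)
    have W1M: "W1 \<subseteq> M"
      using Cons.prems(2) submodD(2,4)[OF M] f by (auto simp: W1_def add_act_def)
    have IH: "weakly_regular (pw ?b M) (add_ell N (pw ?b W1) (pw a M)) (butlast fs)"
      using Cons.IH[OF W1 W1M] Cons.prems Cons by (simp add: W1_def)
    have regf: "u \<in> W" if "u \<in> M" "act f u \<in> W" for u using Cons.prems(5) that by auto
    \<comment> \<open>The next element \<open>f'\<close> supplies the socle condition modulo
      \<open>W1\<close>.\<close>
    have "u \<in> W1" if "u \<in> M" "act f' u \<in> W1" for u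
      using Cons.prems(5) that Cons by (auto simp: W1_def)
    then have soc1: "u \<in> W1" if "u \<in> M" "\<forall>i\<in>{1..N}. act (X i) u \<in> W1" for u
      using irrelevant_act[OF _ W1 that(2), of f'] that(1) Cons.prems(4) Cons by auto
    have pw1: "pw c W1 = add_act (pw c W) f (pw c M)" for c
      unfolding W1_def using submodD(1)[OF W] submodD(1)[OF M] by (rule pw_add_act)
    have "u \<in> add_ell N (pw ?b W) (pw a M)"
      if u: "u \<in> pw ?b M" "act f u \<in> add_ell N (pw ?b W) (pw a M)" for u
    proof -
      obtain w v where wv: "act f u = w + ell N v" "w \<in> pw ?b W" "v \<in> pw a M"
        using u(2) by (auto simp: add_ell_def)
      \<comment> \<open>This puts \<open>ell N v\<close> into the truncation of
        \<open>W1 = W + f M\<close>, so McCoy's argument applies to \<open>v\<close> modulo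
        \<open>W1\<close>.\<close>
      have "ell N v = act (- 1) w + act f u"
        using wv(1) by simp
      moreover have "act (- 1) w \<in> pw ?b W"
        using submodD(4)[OF submod_pw[OF W] poly_ring_closed(7)[OF poly_ring_closed(2)]] wv(2) by blast
      ultimately have "ell N v \<in> pw ?b W1" using u(1) unfolding pw1 add_act_def by blast
      from ell_mccoy[OF W1 M soc1 wv(3) this] have "v \<in> pw a W1" by blast
      then obtain w' v' where wv': "v = w' + act f v'" "w' \<in> pw a W" "v' \<in> pw a M"
        unfolding pw1 add_act_def by blast
      \<comment> \<open>This element has the same class as \<open>u\<close> in the cokernel, and
        \<open>f\<close> sends it into the truncation of \<open>W\<close>; the regularity of
        \<open>f\<close> then applies to each slot.\<close>
      let ?u = "u - ell N v'"
      have ev': "ell N v' \<in> pw ?b M" by (rule ell_pw[OF M wv'(3) assms(2)])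
      have "act f ?u = w + ell N w'" using wv(1) wv'(1) by (simp add: ell_add ell_act)
      moreover have "w + ell N w' \<in> pw ?b W"
        using ell_pw[OF W wv'(2) assms(2)] wv(2) submodD(2)[OF submod_pw[OF W]] by blast
      ultimately have 1: "act f ?u \<in> pw ?b W" by simp
      have 2: "?u \<in> pw ?b M" using u(1) ev' submodD(3)[OF submod_pw[OF M]] by blast
      have "slot j ?u \<in> W" for j
      proof (rule regf)
        show "slot j ?u \<in> M" using slot_in[OF 2 submodD(1)[OF M]] .
        show "act f (slot j ?u) \<in> W" using slot_in[OF 1 submodD(1)[OF W], of j] by simp
      qed
      then have "?u \<in> pw ?b W" using 2 by (auto simp: pw_def)
      moreover have "u = ?u + ell N v'" by simp
      ultimately show ?thesis unfolding add_ell_def using wv'(3) by blast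
    qed
    \<comment> \<open>Passing to the quotient by \<open>f\<close> and to the cokernel of the form
      commute, so the induction hypothesis concerns exactly the remaining quotient.\<close>
    moreover have "add_act (add_ell N (pw ?b W) (pw a M)) f (pw ?b M) = add_ell N (pw ?b W1) (pw a M)"
    proof (intro equalityI subsetI)
      fix e assume "e \<in> add_act (add_ell N (pw ?b W) (pw a M)) f (pw ?b M)"
      then obtain w v u where e: "e = (w + ell N v) + act f u"
          and wvu: "w \<in> pw ?b W" "v \<in> pw a M" "u \<in> pw ?b M"
        unfolding add_act_def add_ell_def by blast
      have "e = (w + act f u) + ell N v" using e by (simp add: ac_simps)
      then show "e \<in> add_ell N (pw ?b W1) (pw a M)"
        using wvu unfolding pw1 add_act_def add_ell_def by blast
    next
      fix e assume "e \<in> add_ell N (pw ?b W1) (pw a M)"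
      then obtain w v u where e: "e = (w + act f u) + ell N v"
          and wvu: "w \<in> pw ?b W" "v \<in> pw a M" "u \<in> pw ?b M"
        unfolding pw1 add_act_def add_ell_def by blast
      have "e = (w + ell N v) + act f u" using e by (simp add: ac_simps)
      then show "e \<in> add_act (add_ell N (pw ?b W) (pw a M)) f (pw ?b M)"
        using wvu unfolding add_act_def add_ell_def by blast
    qed
    ultimately show ?thesis using IH Cons by simp
  qed
qed

section \<open>Gradings\<close>

lemma mon_deg_superset:
  assumes "finite A" "Poly_Mapping.keys m \<subseteq> A"
  shows "mon_deg m = (\<Sum>i\<in>A. Poly_Mapping.lookup m i)"
  unfolding mon_deg_def using assms
  by (intro sum.mono_neutral_left) (auto simp: in_keys_iff)

lemma mon_deg_add: "mon_deg (m + n) = mon_deg m + mon_deg n"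
proof -
  let ?A = "Poly_Mapping.keys m \<union> Poly_Mapping.keys n"
  have "Poly_Mapping.keys (m + n) \<subseteq> ?A" by (rule Poly_Mapping.keys_add)
  then show ?thesis
    using mon_deg_superset[of ?A m] mon_deg_superset[of ?A n] mon_deg_superset[of ?A "m + n"]
    by (simp add: lookup_add sum.distrib)
qed

lemma mon_deg_single [simp]: "mon_deg (Poly_Mapping.single i a) = a"
  by (simp add: mon_deg_def)

lift_definition hpart :: "int \<Rightarrow> 'k::zero polynomial \<Rightarrow> 'k polynomial"
  is "\<lambda>d p m. if int (mon_deg m) = d then p m else 0"
proof -
  fix d and p :: "(nat \<Rightarrow>\<^sub>0 nat) \<Rightarrow> 'k" assume "finite {m. p m \<noteq> 0}"
  then show "finite {m. (if int (mon_deg m) = d then p m else 0) \<noteq> 0}"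
    by (rule rev_finite_subset) auto
qed

lemma lookup_hpart:
  "Poly_Mapping.lookup (hpart d p) m = (if int (mon_deg m) = d then Poly_Mapping.lookup p m else 0)"
  by (simp add: hpart.rep_eq)

lemma hpart_simps [simp]:
  fixes p q :: "'k::field polynomial"
  shows "hpart d 0 = (0 :: 'k polynomial)" "hpart d (p + q) = hpart d p + hpart d q"
    "hpart d (p - q) = hpart d p - hpart d q" "hpart d (- p) = - hpart d p"
    "hpart d (hpart d p) = hpart d p"
  by (auto intro!: poly_mapping_eqI simp: lookup_hpart lookup_add lookup_minus)

lemma hpart_sum: "hpart d (\<Sum>i\<in>I. f i) = (\<Sum>i\<in>I. hpart d (f i :: 'k::field polynomial))"
  by (induction I rule: infinite_finite_induct) simp_all

lemma keys_hpart: "m \<in> Poly_Mapping.keys (hpart d p) \<longleftrightarrow> m \<in> Poly_Mapping.keys p \<and> int (mon_deg m) = d"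
  by (auto simp: in_keys_iff lookup_hpart)

lemma hpart_homogeneous: "p \<in> homogeneous N d \<longleftrightarrow> p \<in> carrier (poly_ring N) \<and> hpart d p = p"
proof -
  have "hpart d p = p \<longleftrightarrow> (\<forall>m\<in>Poly_Mapping.keys p. int (mon_deg m) = d)"
    by (auto simp: poly_mapping_eq_iff fun_eq_iff lookup_hpart in_keys_iff)
  then show ?thesis by (auto simp: homogeneous_def)
qed

lemma hpart_carrier: "p \<in> carrier (poly_ring N) \<Longrightarrow> hpart d p \<in> carrier (poly_ring N)"
  by (auto simp: carrier_poly_ring keys_hpart)

lemma hpart_single: "hpart d (Poly_Mapping.single m c) = (if int (mon_deg m) = d then Poly_Mapping.single m c else 0)"
  by (auto intro!: poly_mapping_eqI simp: lookup_hpart lookup_single when_def)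

lemma poly_mapping_sum_single:
  "(p :: 'a \<Rightarrow>\<^sub>0 'b::comm_monoid_add) = (\<Sum>m\<in>Poly_Mapping.keys p. Poly_Mapping.single m (Poly_Mapping.lookup p m))"
  by (rule poly_mapping_eqI) (auto simp: lookup_sum lookup_single when_def in_keys_iff sum.delta' cong: if_cong)

text \<open>Both sides are additive in \<open>p\<close>, which reduces the claim to monomials, whose
  degrees add.\<close>

lemma hpart_single_mult:
  fixes p :: "'k::field polynomial"
  shows "hpart d (Poly_Mapping.single n c * p) = Poly_Mapping.single n c * hpart (d - int (mon_deg n)) p"
proof -
  have *: "hpart d (Poly_Mapping.single n c * Poly_Mapping.single m b)
      = Poly_Mapping.single n c * hpart (d - int (mon_deg n)) (Poly_Mapping.single m b)" for m and b :: 'k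
    by (auto simp: mult_single hpart_single mon_deg_add)
  show ?thesis
    by (subst (1 2) poly_mapping_sum_single[of p]) (simp add: sum_distrib_left hpart_sum *)
qed

lemma hpart_X_mult: "hpart d (X i * p) = X i * hpart (d - 1) (p :: 'k::field polynomial)"
  by (simp add: X_def hpart_single_mult)

lemma hpart_const_mult: "hpart d (const c * p) = const c * hpart d (p :: 'k::field polynomial)"
  by (simp add: const_def hpart_single_mult mon_deg_def)

text \<open>The generator with number \<open>k\<close> has degree \<open>s k\<close>; the auxiliary variables have degree \<open>0\<close>.\<close>

definition part :: "(nat \<Rightarrow> int) \<Rightarrow> int \<Rightarrow> 'k::field array \<Rightarrow> 'k array"
  where "part s i e = Array (\<lambda>xs k. hpart (i - s k) (entry e xs k))"

lemma entry_part [simp]: "entry (part s i e) xs k = hpart (i - s k) (entry e xs k)"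
  by (simp add: part_def)

lemma part_simps [simp]:
  "part s i 0 = 0" "part s i (e + e') = part s i e + part s i e'"
  "part s i (e - e') = part s i e - part s i e'"
  "part s i (part s i e) = part s i e" "part s i (act (const c) e) = act (const c) (part s i e)"
  "slot j (part s i e) = part s i (slot j e)" "nil_free e \<Longrightarrow> nil_free (part s i e)"
  by (auto intro!: array_ext simp: hpart_const_mult nil_free_def)

lemma part_act_X: "part s i (act (X j) e) = act (X j) (part s (i - 1) e)"
  by (rule array_ext) (simp add: hpart_X_mult diff_diff_eq add.commute)

lemma part_sum: "part s i (\<Sum>j\<in>I. f j) = (\<Sum>j\<in>I. part s i (f j))"
  by (induction I rule: infinite_finite_induct) simp_all

text \<open>The auxiliary variable has degree 0 and every \<open>X i\<close> degree 1, so the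
  generic form is homogeneous of degree 1.\<close>

lemma part_ell: "part s i (ell N e) = ell N (part s (i - 1) e)"
  by (rule array_eqI) (auto simp: conv_def part_sum part_act_X intro!: sum.cong)

definition hom_component :: "(nat \<Rightarrow> int) \<Rightarrow> int \<Rightarrow> 'k::field array set \<Rightarrow> 'k array set"
  where "hom_component s i V = {u \<in> V. part s i u = u}"

definition graded :: "(nat \<Rightarrow> int) \<Rightarrow> 'k::field array set \<Rightarrow> bool"
  where "graded s V \<longleftrightarrow> (\<forall>i. \<forall>u\<in>V. part s i u \<in> V)"

lemma subspace_comp: "arr.subspace V \<Longrightarrow> arr.subspace (hom_component s i V)"
  by (auto simp: arr.subspace_def hom_component_def)

lemma comp_mono: "U \<subseteq> V \<Longrightarrow> hom_component s i U \<subseteq> hom_component s i V"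
  by (auto simp: hom_component_def)

lemma graded_pw: "graded s V \<Longrightarrow> graded s (pw b V)"
  by (auto simp: graded_def pw_def)

lemma graded_add_ell: "graded s W \<Longrightarrow> graded s M \<Longrightarrow> graded s (add_ell N W M)"
  unfolding graded_def add_ell_def by (auto simp: part_ell) metis

text \<open>Projecting any representation \<open>w + ell N u\<close> of a homogeneous element to
  degree \<open>i\<close> yields a representation by homogeneous \<open>w\<close> and
  \<open>u\<close>.\<close>

lemma comp_add_ell:
  assumes "graded s W" "graded s M"
  shows "hom_component s i (add_ell N W M) = {w + ell N u | w u. w \<in> hom_component s i W \<and> u \<in> hom_component s (i - 1) M}"
proof (intro equalityI subsetI)
  fix e assume "e \<in> hom_component s i (add_ell N W M)"
  then obtain w u where e: "e = w + ell N u" "part s i e = e" and wu: "w \<in> W" "u \<in> M"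
    by (auto simp: hom_component_def add_ell_def)
  have "part s i e = part s i w + ell N (part s (i - 1) u)" unfolding e(1) by (simp add: part_ell)
  then have "e = part s i w + ell N (part s (i - 1) u)" using e(2) by simp
  moreover have "part s i w \<in> hom_component s i W" "part s (i - 1) u \<in> hom_component s (i - 1) M"
    using wu assms by (auto simp: hom_component_def graded_def)
  ultimately show "e \<in> {w + ell N u | w u. w \<in> hom_component s i W \<and> u \<in> hom_component s (i - 1) M}" by blast
next
  fix e assume "e \<in> {w + ell N u | w u. w \<in> hom_component s i W \<and> u \<in> hom_component s (i - 1) M}"
  then show "e \<in> hom_component s i (add_ell N W M)" by (auto simp: hom_component_def add_ell_def part_ell)
qed

lemma linear_arrI:
  assumes "\<And>u v. f (u + v) = f u + f v" "\<And>c u. f (act (const c) u) = act (const c) (f u)"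
  shows "Vector_Spaces.linear (\<lambda>c. act (const c)) (\<lambda>c. act (const c)) f"
  by unfold_locales (auto simp: assms)

lemma dim_zero: "arr.dim {0} = 0" "arr.findim {0}"
  using arr.dim_le_card[of "{0}" "{}"] by (auto simp: arr.findim_def)

definition place :: "nat \<Rightarrow> 'k::field array \<Rightarrow> 'k array"
  where "place b e = mk_array (\<lambda>j. if j = b then e else 0)"

text \<open>Raising the bound by one adds a copy of \<open>V\<close> as the coefficients of
  \<open>t^b\<close>. The sum is direct, so \<open>dim_add_image\<close> is used with
  \<open>A1 = {0}\<close>.\<close>

lemma dim_comp_pw:
  assumes "arr.subspace V" "arr.findim (hom_component s i V)"
  shows "arr.findim (hom_component s i (pw b V)) \<and> arr.dim (hom_component s i (pw b V)) = b * arr.dim (hom_component s i V)"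
proof (induction b)
  case 0
  have "hom_component s i (pw 0 V) = {0}"
    by (auto simp: hom_component_def pw_def intro: array_eqI[of _ 0])
  then show ?case using dim_zero by simp
next
  case (Suc b)
  have zV: "0 \<in> V" using assms(1) by (simp add: arr.subspace_def)
  have sub: "arr.subspace (pw b V)"
    using assms(1) by (auto simp: arr.subspace_def pw_def)
  have lin: "Vector_Spaces.linear (\<lambda>c. act (const c)) (\<lambda>c. act (const c)) (place b)"
    by (rule linear_arrI; rule array_eqI) (auto simp: place_def)
  have eq: "hom_component s i (pw (Suc b) V) = {w + place b u | w u. w \<in> hom_component s i (pw b V) \<and> u \<in> hom_component s i V}"
  proof (intro equalityI subsetI)
    fix e assume e: "e \<in> hom_component s i (pw (Suc b) V)"
    let ?w = "e - place b (slot b e)"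
    have h: "part s i (slot b e) = slot b e" using e by (simp add: hom_component_def flip: part_simps(6))
    moreover have "part s i (place b (slot b e)) = place b (slot b e)"
      by (rule array_eqI) (auto simp: place_def h)
    ultimately have "?w \<in> hom_component s i (pw b V)" "slot b e \<in> hom_component s i V"
      using e zV by (auto simp: hom_component_def pw_def place_def not_less_eq_eq)
    moreover have "e = ?w + place b (slot b e)" by simp
    ultimately show "e \<in> {w + place b u | w u. w \<in> hom_component s i (pw b V) \<and> u \<in> hom_component s i V}" by blast
  next
    fix e assume "e \<in> {w + place b u | w u. w \<in> hom_component s i (pw b V) \<and> u \<in> hom_component s i V}"
    then obtain w u where e: "e = w + place b u" "w \<in> hom_component s i (pw b V)" "u \<in> hom_component s i V" by blast
    have "part s i (place b u) = place b u"
      using e(3) by (rule_tac array_eqI) (auto simp: place_def hom_component_def)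
    then show "e \<in> hom_component s i (pw (Suc b) V)"
      using e zV by (auto simp: hom_component_def pw_def place_def less_Suc_eq)
  qed
  have pre: "place b u \<in> hom_component s i (pw b V) \<longleftrightarrow> u \<in> {0}" if "u \<in> hom_component s i V" for u
  proof
    assume "place b u \<in> hom_component s i (pw b V)"
    then have "slot b (place b u) = 0" by (simp add: hom_component_def pw_def)
    then show "u \<in> {0}" by (simp add: place_def)
  next
    assume "u \<in> {0}"
    then have "place b u = 0" by (intro array_eqI[of "place b u" 0]) (auto simp: place_def)
    then show "place b u \<in> hom_component s i (pw b V)"
      using arr.subspace_0[OF subspace_comp[OF sub]] by simp
  qed
  have z: "arr.subspace {0}" "{0} \<subseteq> hom_component s i V"
    using zV by (auto simp: arr.subspace_def hom_component_def)
  note * = arr.dim_add_image[OF lin assms(2) subspace_comp[OF assms(1)] z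
      conjunct1[OF Suc.IH] subspace_comp[OF sub] pre]
  show ?case unfolding eq using * Suc.IH by (simp add: dim_zero)
qed

section \<open>Hilbert functions of subquotients\<close>

definition presentation :: "nat \<Rightarrow> (nat \<Rightarrow> int) \<Rightarrow> 'k::field array set \<Rightarrow> 'k array set \<Rightarrow> bool"
  where "presentation N s M W \<longleftrightarrow> submod N M \<and> submod N W \<and> W \<subseteq> M \<and> graded s M \<and> graded s W \<and>
    (\<forall>i. arr.findim (hom_component s i M))"

text \<open>The Hilbert function of \<open>M/W\<close>, integer-valued so that differences of it may
  be formed.\<close>

definition quotient_dim :: "(nat \<Rightarrow> int) \<Rightarrow> 'k::field array set \<Rightarrow> 'k array set \<Rightarrow> int \<Rightarrow> int"
  where "quotient_dim s M W i = int (arr.dim (hom_component s i M)) - int (arr.dim (hom_component s i W))"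

lemma quotient_dim_nonneg:
  assumes "presentation N s M W"
  shows "0 \<le> quotient_dim s M W i"
  using assms arr.findim_dim_mono[of "hom_component s i M" "hom_component s i W"]
  by (auto simp: presentation_def quotient_dim_def subspace_comp submod_subspace comp_mono)

text \<open>Multiplication by the generic form is homogeneous of degree 1 and injective modulo
  \<open>W\<close>. The cokernel therefore loses \<open>a\<close> copies of degree
  \<open>i - 1\<close> from the \<open>b\<close> copies of degree \<open>i\<close>.\<close>

lemma presentation_add_ell:
  fixes M W :: "'a::field array set" and a b :: nat
  assumes P: "presentation N s M W" and "N \<ge> 1"
    and soc: "\<And>u. u \<in> M \<Longrightarrow> \<forall>i\<in>{1..N}. act (X i) u \<in> W \<Longrightarrow> u \<in> W"
  defines "b \<equiv> a + N - 1"
  defines "W' \<equiv> add_ell N (pw b W) (pw a M)"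
  shows "presentation N s (pw b M) W'"
    and "quotient_dim s (pw b M) W' i = int b * quotient_dim s M W i - int a * quotient_dim s M W (i - 1)"
proof -
  have M: "submod N M" and W: "submod N W" and "W \<subseteq> M" and gr: "graded s M" "graded s W"
    and fin: "\<And>i. arr.findim (hom_component s i M)" using P by (auto simp: presentation_def)
  have finW: "arr.findim (hom_component s i W)" for i
    using arr.findim_subset[OF fin comp_mono[OF \<open>W \<subseteq> M\<close>]] .
  note dM = dim_comp_pw[OF submod_subspace[OF M] fin] and dW = dim_comp_pw[OF submod_subspace[OF W] finW]
  have ellM: "ell N u \<in> pw b M" if "u \<in> pw a M" for u
    unfolding b_def using ell_pw[OF M that \<open>N \<ge> 1\<close>] .
  have "W' \<subseteq> pw b M"
    using ellM pw_mono[OF \<open>W \<subseteq> M\<close>, of b] submodD(2)[OF submod_pw[OF M]]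
    by (auto simp: W'_def add_ell_def)
  then show "presentation N s (pw b M) W'"
    unfolding presentation_def W'_def
    using submod_pw[OF M] submod_add_ell[OF submod_pw[OF W] submod_pw[OF M]] gr dM
    by (auto simp: graded_pw graded_add_ell)
  have lin: "Vector_Spaces.linear (\<lambda>c. act (const c)) (\<lambda>c. act (const c)) (ell N)"
    by (intro linear_arrI) (auto simp: ell_add ell_act)
  have eq: "hom_component s i W' = {w + ell N u | w u. w \<in> hom_component s i (pw b W) \<and> u \<in> hom_component s (i - 1) (pw a M)}"
    unfolding W'_def using gr by (intro comp_add_ell graded_pw)
  have pre: "ell N u \<in> hom_component s i (pw b W) \<longleftrightarrow> u \<in> hom_component s (i - 1) (pw a W)"
    if u: "u \<in> hom_component s (i - 1) (pw a M)" for u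
  proof
    assume "ell N u \<in> hom_component s i (pw b W)"
    then have "u \<in> pw a W" using ell_mccoy[OF W M soc, of u a b] u by (auto simp: hom_component_def)
    then show "u \<in> hom_component s (i - 1) (pw a W)" using u by (simp add: hom_component_def)
  next
    assume "u \<in> hom_component s (i - 1) (pw a W)"
    then show "ell N u \<in> hom_component s i (pw b W)"
      using ell_pw[OF W _ \<open>N \<ge> 1\<close>] by (auto simp: hom_component_def part_ell b_def)
  qed
  have sp: "arr.subspace (hom_component s j (pw c V))" if "submod N V" for j c and V :: "'a array set"
    using that by (intro subspace_comp submod_subspace submod_pw)
  have "arr.dim (hom_component s i W') + arr.dim (hom_component s (i - 1) (pw a W))
      = arr.dim (hom_component s i (pw b W)) + arr.dim (hom_component s (i - 1) (pw a M))"
    unfolding eq using dM dW pre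
    by (intro arr.dim_add_image[OF lin] sp M W comp_mono pw_mono \<open>W \<subseteq> M\<close>) auto
  then have "arr.dim (hom_component s i W') + a * arr.dim (hom_component s (i - 1) W)
      = b * arr.dim (hom_component s i W) + a * arr.dim (hom_component s (i - 1) M)"
    using dM dW by metis
  from arg_cong[OF this, of int]
  have "int (arr.dim (hom_component s i W')) + int a * int (arr.dim (hom_component s (i - 1) W))
      = int b * int (arr.dim (hom_component s i W)) + int a * int (arr.dim (hom_component s (i - 1) M))"
    by simp
  then show "quotient_dim s (pw b M) W' i = int b * quotient_dim s M W i - int a * quotient_dim s M W (i - 1)"
    using dM by (simp add: quotient_dim_def algebra_simps)
qed

text \<open>On generating series this is multiplication by \<open>b - a T\<close>; for
  \<open>a = b = 1\<close> it is the backward difference, that is, multiplication by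
  \<open>1 - T\<close>.\<close>

definition weighted_diff :: "'a::comm_ring_1 \<Rightarrow> 'a \<Rightarrow> (int \<Rightarrow> 'a) \<Rightarrow> int \<Rightarrow> 'a"
  where "weighted_diff b a h i = b * h i - a * h (i - 1)"

text \<open>Each step replaces \<open>M/W\<close> by the cokernel of the generic form, at the cost
  of the last sequence element and of one application of the operator. When the sequence is used up,
  the claim is that a dimension is nonnegative.\<close>

lemma weighted_diff_quotient_dim_nonneg:
  assumes "N \<ge> 1"
  shows "presentation N s M W \<Longrightarrow> set fs \<subseteq> irrelevant_ideal N \<Longrightarrow> weakly_regular M W fs \<Longrightarrow>
    0 \<le> (weighted_diff (int (a + N - 1)) (int a) ^^ length fs) (quotient_dim s M W) i"
proof (induction "length fs" arbitrary: fs M W i)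
  case 0
  then show ?case by (simp add: quotient_dim_nonneg)
next
  case (Suc d)
  let ?b = "a + N - 1"
  let ?W' = "add_ell N (pw ?b W) (pw a M)"
  have M: "submod N M" and W: "submod N W" and "W \<subseteq> M" using Suc.prems by (auto simp: presentation_def)
  obtain f fs' where fs: "fs = f # fs'" using Suc.hyps(2) by (cases fs) auto
  \<comment> \<open>The head \<open>f\<close> lies in the irrelevant ideal, so it carries such a
    \<open>u\<close> into \<open>W\<close> and regularity applies.\<close>
  have soc: "u \<in> W" if "u \<in> M" "\<forall>i\<in>{1..N}. act (X i) u \<in> W" for u
    using irrelevant_act[OF _ W that(2), of f] that(1) Suc.prems fs by auto
  have "set (butlast fs) \<subseteq> irrelevant_ideal N" using Suc.prems(2) by (meson in_set_butlastD subset_code(1))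
  moreover have "weakly_regular (pw ?b M) ?W' (butlast fs)"
    using weakly_regular_add_ell[OF M \<open>N \<ge> 1\<close> W \<open>W \<subseteq> M\<close> _ Suc.prems(2,3), of a] fs by simp
  ultimately have "0 \<le> (weighted_diff (int ?b) (int a) ^^ length (butlast fs)) (quotient_dim s (pw ?b M) ?W') i"
    using Suc.hyps(2) presentation_add_ell(1)[OF Suc.prems(1) \<open>N \<ge> 1\<close> soc]
    by (intro Suc.hyps(1)) auto
  moreover have "quotient_dim s (pw ?b M) ?W' = weighted_diff (int ?b) (int a) (quotient_dim s M W)"
    using presentation_add_ell(2)[OF Suc.prems(1) \<open>N \<ge> 1\<close> soc] by (intro ext) (simp add: weighted_diff_def)
  moreover have "(w ^^ length fs) x = (w ^^ length (butlast fs)) (w x)" for w and x :: "int \<Rightarrow> int"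
    unfolding fs by (simp add: funpow_swap1)
  ultimately show ?case by (simp only:)
qed

lemma weighted_diff_Suc:
  "(weighted_diff b a ^^ Suc d) h i = b * (weighted_diff b a ^^ d) h i - a * (weighted_diff b a ^^ d) h (i - 1)"
  by (simp add: weighted_diff_def[of b a "(weighted_diff b a ^^ d) h" i])

text \<open>Dividing each factor \<open>(a + c) - a T\<close> by \<open>a + c\<close> leaves
  \<open>1 - (a / (a + c)) T\<close>, which tends to \<open>1 - T\<close>. A fixed coefficient of
  the product involves only finitely many values of \<open>h\<close>.\<close>

lemma weighted_diff_limit:
  fixes h :: "int \<Rightarrow> int"
  shows "(\<lambda>a. real_of_int ((weighted_diff (int (a + c)) (int a) ^^ d) h i) / real (a + c) ^ d)
    \<longlonglongrightarrow> real_of_int ((weighted_diff 1 1 ^^ d) h i)"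
proof (induction d arbitrary: i)
  case 0
  then show ?case by simp
next
  case (Suc d)
  let ?g = "\<lambda>i a. real_of_int ((weighted_diff (int (a + c)) (int a) ^^ d) h i) / real (a + c) ^ d"
  have ratio: "(\<lambda>a. real a / real (a + c)) \<longlonglongrightarrow> 1"
    by real_asymp
  have "(\<lambda>a. ?g i a - real a / real (a + c) * ?g (i - 1) a) \<longlonglongrightarrow>
      real_of_int ((weighted_diff 1 1 ^^ d) h i) - 1 * real_of_int ((weighted_diff 1 1 ^^ d) h (i - 1))"
    by (intro tendsto_diff tendsto_mult ratio Suc.IH)
  moreover have "eventually (\<lambda>a. ?g i a - real a / real (a + c) * ?g (i - 1) a =
      real_of_int ((weighted_diff (int (a + c)) (int a) ^^ Suc d) h i) / real (a + c) ^ Suc d) sequentially"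
    using eventually_gt_at_top[of 0]
  proof eventually_elim
    case (elim a)
    have "x / B ^ d - y / B * (z / B ^ d) = (B * x - y * z) / B ^ Suc d" if "B > 0" for x y z B :: real
      using that by (simp add: field_simps)
    from this[of "real (a + c)"] elim show ?case
      by (simp add: weighted_diff_Suc del: funpow.simps)
  qed
  ultimately show ?case by (simp add: weighted_diff_Suc tendsto_cong del: funpow.simps)
qed

lemma difference_quotient_dim_nonneg:
  assumes "N \<ge> 1" "presentation N s M W" "set fs \<subseteq> irrelevant_ideal N" "weakly_regular M W fs"
  shows "0 \<le> (weighted_diff 1 1 ^^ length fs) (quotient_dim s M W) i"
proof -
  have "0 \<le> real_of_int ((weighted_diff 1 1 ^^ length fs) (quotient_dim s M W) i)"
  \<comment> \<open>The choice \<open>c = N - 1\<close> matches the truncation bound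
    \<open>b = a + N - 1\<close>.\<close>
  proof (rule tendsto_lowerbound[OF weighted_diff_limit[of "length fs" "N - 1"]])
    show "\<forall>\<^sub>F a in sequentially. 0 \<le> real_of_int ((weighted_diff (int (a + (N - 1))) (int a) ^^ length fs) (quotient_dim s M W) i)
        / real (a + (N - 1)) ^ length fs"
      using weighted_diff_quotient_dim_nonneg[OF assms, of _ i] assms(1)
      by (intro always_eventually allI divide_nonneg_nonneg) auto
  qed simp
  then show ?thesis by simp
qed

section \<open>Presentations of graded modules\<close>

context linear_space
begin

text \<open>The Hilbert series uses vector spaces with an explicit carrier, while the dimension
  counts above live in a type. The axioms are transported along a linear surjection from a subspace
  of the type.\<close>

lemma vectorspace_image:
  fixes V :: "('k, 'c, 'm) module_scheme"
  assumes A: "subspace A" and im: "\<phi> ` A = carrier V"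
    and add: "\<And>x y. x \<in> A \<Longrightarrow> y \<in> A \<Longrightarrow> \<phi> (x + y) = \<phi> x \<oplus>\<^bsub>V\<^esub> \<phi> y"
    and scl: "\<And>c x. x \<in> A \<Longrightarrow> \<phi> (scale c x) = c \<odot>\<^bsub>V\<^esub> \<phi> x"
    and zero: "\<phi> 0 = \<zero>\<^bsub>V\<^esub>"
  shows "vectorspace (class_ring :: 'k ring) V"
proof -
  have mem: "\<phi> x \<in> carrier V" if "x \<in> A" for x using im that by blast
  have ex: "\<exists>x\<in>A. u = \<phi> x" if "u \<in> carrier V" for u using that unfolding im[symmetric] by blast
  have "abelian_group V"
  proof (rule abelian_groupI)
    fix u v assume "u \<in> carrier V" "v \<in> carrier V"
    then obtain x y where xy: "u = \<phi> x" "v = \<phi> y" "x \<in> A" "y \<in> A" using ex by metis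
    show "u \<oplus>\<^bsub>V\<^esub> v \<in> carrier V"
      using xy mem[of "x + y"] subspace_add[OF A] by (simp add: add)
    show "u \<oplus>\<^bsub>V\<^esub> v = v \<oplus>\<^bsub>V\<^esub> u"
      using xy by (simp flip: add add: add.commute)
    fix w assume "w \<in> carrier V"
    then obtain z where z: "w = \<phi> z" "z \<in> A" using ex by metis
    show "(u \<oplus>\<^bsub>V\<^esub> v) \<oplus>\<^bsub>V\<^esub> w = u \<oplus>\<^bsub>V\<^esub> (v \<oplus>\<^bsub>V\<^esub> w)"
      using xy z subspace_add[OF A] by (simp flip: add add: add.assoc)
  next
    show "\<zero>\<^bsub>V\<^esub> \<in> carrier V" using mem[OF subspace_0[OF A]] by (simp add: zero)
    fix u assume "u \<in> carrier V"
    then obtain x where x: "u = \<phi> x" "x \<in> A" using ex by metis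
    show "\<zero>\<^bsub>V\<^esub> \<oplus>\<^bsub>V\<^esub> u = u"
      using x subspace_0[OF A] by (simp flip: add zero)
    show "\<exists>v\<in>carrier V. v \<oplus>\<^bsub>V\<^esub> u = \<zero>\<^bsub>V\<^esub>"
      using x subspace_neg[OF A] mem by (intro bexI[of _ "\<phi> (- x)"]) (auto simp flip: add zero)
  qed
  then have "Module.module (class_ring :: 'k ring) V"
  proof (intro moduleI)
    show "cring (class_ring :: 'k ring)" by (rule class_cring.is_cring)
    fix c d :: 'k and u v assume uv: "u \<in> carrier V"
    then obtain x where x: "u = \<phi> x" "x \<in> A" using ex by metis
    show "c \<odot>\<^bsub>V\<^esub> u \<in> carrier V"
      using x mem[OF subspace_scale[OF A]] by (simp flip: scl)
    show "\<one>\<^bsub>(class_ring :: 'k ring)\<^esub> \<odot>\<^bsub>V\<^esub> u = u" using x by (simp flip: scl)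
    show "(c \<otimes>\<^bsub>class_ring\<^esub> d) \<odot>\<^bsub>V\<^esub> u = c \<odot>\<^bsub>V\<^esub> (d \<odot>\<^bsub>V\<^esub> u)"
      using x subspace_scale[OF A] by (simp flip: scl)
    show "(c \<oplus>\<^bsub>class_ring\<^esub> d) \<odot>\<^bsub>V\<^esub> u = c \<odot>\<^bsub>V\<^esub> u \<oplus>\<^bsub>V\<^esub> d \<odot>\<^bsub>V\<^esub> u"
      using x subspace_scale[OF A] by (simp flip: scl add add: scale_left_distrib)
    assume "v \<in> carrier V"
    then obtain y where y: "v = \<phi> y" "y \<in> A" using ex by metis
    show "c \<odot>\<^bsub>V\<^esub> (u \<oplus>\<^bsub>V\<^esub> v) = c \<odot>\<^bsub>V\<^esub> u \<oplus>\<^bsub>V\<^esub> c \<odot>\<^bsub>V\<^esub> v"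
      using x y subspace_scale[OF A] subspace_add[OF A] by (simp flip: scl add add: scale_right_distrib)
  qed simp_all
  then show ?thesis
    unfolding vectorspace_def using class_field by blast
qed

text \<open>Rank and nullity across the two notions of dimension: a basis \<open>C1\<close> of the
  kernel is extended to a basis \<open>C\<close> of \<open>A\<close>, and the images of
  \<open>C - C1\<close> form a basis of \<open>V\<close>.\<close>

lemma dim_vectorspace_image:
  fixes V :: "('k, 'c, 'm) module_scheme"
  assumes A: "subspace A" and im: "\<phi> ` A = carrier V"
    and add: "\<And>x y. x \<in> A \<Longrightarrow> y \<in> A \<Longrightarrow> \<phi> (x + y) = \<phi> x \<oplus>\<^bsub>V\<^esub> \<phi> y"
    and scl: "\<And>c x. x \<in> A \<Longrightarrow> \<phi> (scale c x) = c \<odot>\<^bsub>V\<^esub> \<phi> x"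
    and zero: "\<phi> 0 = \<zero>\<^bsub>V\<^esub>" and fin: "findim A"
  shows "vectorspace.dim (class_ring :: 'k ring) V + dim {x \<in> A. \<phi> x = \<zero>\<^bsub>V\<^esub>} = dim A"
proof -
  interpret V: vectorspace "class_ring :: 'k ring" V
    by (rule vectorspace_image[OF A im add scl zero])
  let ?K = "{x \<in> A. \<phi> x = \<zero>\<^bsub>V\<^esub>}"
  have mem: "\<phi> x \<in> carrier V" if "x \<in> A" for x using im that by blast
  have K: "subspace ?K"
    using A by (auto simp: subspace_def add scl zero)
  obtain C1 where C1: "finite C1" "independent C1" "C1 \<subseteq> ?K" "span C1 = ?K" "card C1 = dim ?K"
    using findim_basis[OF findim_subset[OF fin, of ?K] K] by auto
  obtain C where C: "C1 \<subseteq> C" "finite C" "independent C" "C \<subseteq> A" "span C = A" "card C = dim A"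
    using findim_basis_extend[OF fin A C1(2)] C1(3) by auto
  define G where "G = C - C1"
  have G: "finite G" "C1 \<union> G = C" "C1 \<inter> G = {}" "G \<subseteq> A" using C(1,2,4) by (auto simp: G_def)
  have hsum: "\<phi> (\<Sum>x\<in>F. scale (a x) x) = (\<Oplus>\<^bsub>V\<^esub>x\<in>F. a x \<odot>\<^bsub>V\<^esub> \<phi> x)" if "F \<subseteq> A" "finite F" for a F
    using that(2,1)
  proof (induction F rule: finite_induct)
    case empty
    then show ?case by (simp add: zero)
  next
    case (insert x F)
    have "(\<Sum>x\<in>F. scale (a x) x) \<in> A"
      using insert.prems by (intro subspace_sum[OF A] subspace_scale[OF A]) auto
    then have "\<phi> (\<Sum>x\<in>insert x F. scale (a x) x) = a x \<odot>\<^bsub>V\<^esub> \<phi> x \<oplus>\<^bsub>V\<^esub> \<phi> (\<Sum>x\<in>F. scale (a x) x)"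
      using insert subspace_scale[OF A] by (simp add: add scl)
    also have "\<dots> = (\<Oplus>\<^bsub>V\<^esub>x\<in>insert x F. a x \<odot>\<^bsub>V\<^esub> \<phi> x)"
      using insert mem by (subst V.finsum_insert) auto
    finally show ?case .
  qed
  have coeff: "a g = 0" if s: "(\<Sum>g\<in>G. scale (a g) g) \<in> span C1" and g: "g \<in> G" for a g
  proof (rule ccontr)
    assume "a g \<noteq> 0"
    obtain b where b: "(\<Sum>g\<in>G. scale (a g) g) = (\<Sum>c\<in>C1. scale (b c) c)"
      using s unfolding span_finite[OF C1(1)] by blast
    \<comment> \<open>The difference of the two expressions, read as one linear relation on the
      independent set \<open>C\<close>.\<close>
    let ?u = "\<lambda>v. if v \<in> G then a v else - b v"
    have "(\<Sum>v\<in>C. scale (?u v) v) = (\<Sum>v\<in>C1. scale (?u v) v) + (\<Sum>v\<in>G. scale (?u v) v)"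
      unfolding G(2)[symmetric] by (rule sum.union_disjoint[OF C1(1) G(1,3)])
    also have "(\<Sum>v\<in>C1. scale (?u v) v) = - (\<Sum>c\<in>C1. scale (b c) c)"
      unfolding sum_negf[symmetric] using G(3) by (intro sum.cong) auto
    also have "(\<Sum>v\<in>G. scale (?u v) v) = (\<Sum>g\<in>G. scale (a g) g)"
      by (intro sum.cong) auto
    finally have z: "(\<Sum>v\<in>C. scale (?u v) v) = 0" using b by simp
    have nz: "\<exists>v\<in>C. ?u v \<noteq> 0" using g \<open>a g \<noteq> 0\<close> G(2) by (intro bexI[of _ g]) auto
    have "dependent C"
      unfolding dependent_finite[OF C(2)] by (rule exI[of _ ?u], rule conjI[OF nz z])
    then show False using C(3) by contradiction
  qed
  have inj: "inj_on \<phi> G"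
  proof (rule inj_onI, rule ccontr)
    fix x y assume xy: "x \<in> G" "y \<in> G" "\<phi> x = \<phi> y" "x \<noteq> y"
    have A': "x \<in> A" "y \<in> A" using xy G(4) by auto
    have "\<phi> (x - y) = \<phi> x \<oplus>\<^bsub>V\<^esub> \<phi> (- y)"
      using A' subspace_neg[OF A] by (simp flip: add)
    also have "\<dots> = \<phi> y \<oplus>\<^bsub>V\<^esub> \<phi> (- y)" using xy by simp
    also have "\<dots> = \<zero>\<^bsub>V\<^esub>"
      using A' subspace_neg[OF A] by (simp flip: add add: zero)
    finally have "x - y \<in> ?K" using A' subspace_diff[OF A] by simp
    then have "x - y \<in> span C1" using C1(4) by simp
    then have "x - y \<in> span (C - {x})"
      using xy(1) G(2,3) span_mono[of C1 "C - {x}"] by blast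
    moreover have "y \<in> span (C - {x})" using xy G(2) by (intro span_base) auto
    ultimately have "x - y + y \<in> span (C - {x})" by (rule span_add)
    then show False using C(3) xy(1) G(2) unfolding dependent_def by auto
  qed
  have lin: "V.lincomb a (\<phi> ` G) = \<phi> (\<Sum>g\<in>G. scale (a (\<phi> g)) g)" for a
    unfolding V.lincomb_def hsum[OF G(4,1)] using inj mem G(4)
    by (subst V.add.finprod_reindex) auto
  have B: "\<phi> ` G \<subseteq> carrier V" using mem G(4) by auto
  have sumA: "(\<Sum>g\<in>G. scale (b g) g) \<in> A" for b
    using G(4) by (intro subspace_sum[OF A] subspace_scale[OF A]) auto
  have "V.basis (\<phi> ` G)"
    unfolding V.basis_def
  proof (intro conjI B)
    show "V.lin_indpt (\<phi> ` G)"
    proof (rule V.finite_lin_indpt2)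
      fix a assume "V.lincomb a (\<phi> ` G) = \<zero>\<^bsub>V\<^esub>"
      then have "(\<Sum>g\<in>G. scale (a (\<phi> g)) g) \<in> span C1"
        using sumA C1(4) by (simp add: lin)
      then show "\<forall>v\<in>\<phi> ` G. a v = \<zero>\<^bsub>class_ring\<^esub>" using coeff[of "\<lambda>g. a (\<phi> g)"] by auto
    qed (use G(1) B in auto)
    show "V.span (\<phi> ` G) = carrier V"
    proof
      show "V.span (\<phi> ` G) \<subseteq> carrier V" by (rule V.span_is_subset2[OF B])
      show "carrier V \<subseteq> V.span (\<phi> ` G)"
      proof
        fix v assume "v \<in> carrier V"
        then obtain x where x: "v = \<phi> x" "x \<in> A" unfolding im[symmetric] ..
        then have "x \<in> span (C1 \<union> G)" using C(5) G(2) by simp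
        then obtain k y where ky: "x = k + y" "k \<in> ?K" "y \<in> span G"
          using C1(4) unfolding span_Un by blast
        obtain b where b: "y = (\<Sum>g\<in>G. scale (b g) g)" using ky(3) unfolding span_finite[OF G(1)] by blast
        have "v = \<phi> y" using x ky sumA b add mem[of y] by simp
        \<comment> \<open>Coefficients of \<open>V.lincomb\<close> are indexed by vectors of
          \<open>V\<close>, so \<open>b\<close> has to be transported along the inverse of
          \<open>\<phi>\<close> on \<open>G\<close>.\<close>
        also have "y = (\<Sum>g\<in>G. scale (b (inv_into G \<phi> (\<phi> g))) g)"
          unfolding b using inj by (intro sum.cong) auto
        finally have "v = V.lincomb (\<lambda>v. b (inv_into G \<phi> v)) (\<phi> ` G)" by (simp add: lin)
        then show "v \<in> V.span (\<phi> ` G)" unfolding V.span_def using G(1) by auto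
      qed
    qed
  qed
  then have "V.dim = card G" using V.dim_basis[of "\<phi> ` G"] G(1) inj by (simp add: card_image)
  moreover have "card C = card C1 + card G"
    unfolding G(2)[symmetric] by (rule card_Un_disjoint[OF C1(1) G(1,3)])
  ultimately show ?thesis using C1(5) C(6) by simp
qed

end

section \<open>Monomials and graded free modules\<close>

definition mons :: "nat \<Rightarrow> int \<Rightarrow> (nat \<Rightarrow>\<^sub>0 nat) set"
  where "mons N d = {m. Poly_Mapping.keys m \<subseteq> {1..N} \<and> int (mon_deg m) = d}"

text \<open>Each exponent is bounded by the total degree, so the monomials inject into a finite
  product.\<close>

lemma finite_mons: "finite (mons N d)"
proof -
  let ?F = "PiE {1..N} (\<lambda>_. {0..nat d})"
  have "inj_on (\<lambda>m. restrict (Poly_Mapping.lookup m) {1..N}) (mons N d)"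
  proof (rule inj_onI)
    fix m n assume mn: "m \<in> mons N d" "n \<in> mons N d"
      and eq: "restrict (Poly_Mapping.lookup m) {1..N} = restrict (Poly_Mapping.lookup n) {1..N}"
    show "m = n"
    proof (rule poly_mapping_eqI)
      fix i
      show "Poly_Mapping.lookup m i = Poly_Mapping.lookup n i"
      proof (cases "i \<in> {1..N}")
        case True
        then show ?thesis using fun_cong[OF eq, of i] by simp
      next
        case False
        then have "i \<notin> Poly_Mapping.keys m" "i \<notin> Poly_Mapping.keys n" using mn by (auto simp: mons_def)
        then show ?thesis by (simp add: in_keys_iff)
      qed
    qed
  qed
  moreover have "(\<lambda>m. restrict (Poly_Mapping.lookup m) {1..N}) ` mons N d \<subseteq> ?F"
  proof (intro image_subsetI restrict_PiE_iff[THEN iffD2] ballI)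
    fix m i assume "m \<in> mons N d" "i \<in> {1..N}"
    then have "Poly_Mapping.lookup m i \<le> mon_deg m" "int (mon_deg m) = d"
      using mon_deg_superset[of "{1..N}" m] by (auto simp: mons_def intro: member_le_sum)
    then show "Poly_Mapping.lookup m i \<in> {0..nat d}" by auto
  qed
  ultimately show ?thesis
    by (rule inj_on_finite) (auto intro: finite_PiE)
qed

lemma poly_mapping_sum_superset:
  fixes p :: "'a \<Rightarrow>\<^sub>0 'b::comm_monoid_add"
  assumes "finite T" "Poly_Mapping.keys p \<subseteq> T"
  shows "p = (\<Sum>m\<in>T. Poly_Mapping.single m (Poly_Mapping.lookup p m))"
proof -
  have "p = (\<Sum>m\<in>Poly_Mapping.keys p. Poly_Mapping.single m (Poly_Mapping.lookup p m))"
    by (rule poly_mapping_sum_single)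
  also have "\<dots> = (\<Sum>m\<in>T. Poly_Mapping.single m (Poly_Mapping.lookup p m))"
    using assms by (intro sum.mono_neutral_left) (auto simp: in_keys_iff)
  finally show ?thesis .
qed

lemma homogeneous_keys: "p \<in> homogeneous N d \<longleftrightarrow> Poly_Mapping.keys p \<subseteq> mons N d"
  by (auto simp: homogeneous_def carrier_poly_ring mons_def)

text \<open>The free module of rank \<open>m\<close> over the polynomial ring. Its entries sit at
  the empty list, as no auxiliary variable has been adjoined yet.\<close>

definition free_part :: "nat \<Rightarrow> nat \<Rightarrow> 'k::field array set"
  where "free_part N m = {e. \<forall>xs k. entry e xs k \<in> carrier (poly_ring N) \<and> (entry e xs k \<noteq> 0 \<longrightarrow> xs = [] \<and> k < m)}"

definition unit_array :: "nat \<Rightarrow> 'k::field polynomial \<Rightarrow> 'k array"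
  where "unit_array k p = Array (\<lambda>xs l. if xs = [] \<and> l = k then p else 0)"

lemma entry_unit_array [simp]: "entry (unit_array k p) xs l = (if xs = [] \<and> l = k then p else 0)"
  by (simp add: unit_array_def)

lemma entry_sum: "entry (\<Sum>i\<in>I. f i) xs k = (\<Sum>i\<in>I. entry (f i) xs k)"
  by (induction I rule: infinite_finite_induct) simp_all

lemma submod_free_part: "submod N (free_part N m)"
  by (auto simp: submod_def free_part_def) (metis add.right_neutral)+

lemma graded_free_part: "graded s (free_part N m)"
  by (auto simp: graded_def free_part_def hpart_carrier) (metis hpart_simps(1))+

text \<open>In degree \<open>i\<close>, monomials of degree \<open>i - s k\<close> in position
  \<open>k\<close> span; there are finitely many of them.\<close>

lemma findim_free_part: "arr.findim (hom_component s i (free_part N m :: 'k::field array set))"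
proof -
  let ?B = "(\<lambda>(k, \<mu>). unit_array k (Poly_Mapping.single \<mu> 1) :: 'k array) ` (SIGMA k:{..<m}. mons N (i - s k))"
  have "hom_component s i (free_part N m) \<subseteq> arr.span ?B"
  proof
    fix e :: "'k array" assume e: "e \<in> hom_component s i (free_part N m)"
    have "part s i e = e" using e by (simp add: hom_component_def)
    then have part: "hpart (i - s k) (entry e [] k) = entry e [] k" for k
      by (metis entry_part)
    let ?t = "\<lambda>k \<mu>. act (const (Poly_Mapping.lookup (entry e [] k) \<mu>)) (unit_array k (Poly_Mapping.single \<mu> 1))"
    have "e = (\<Sum>k<m. \<Sum>\<mu>\<in>mons N (i - s k). ?t k \<mu>)"
    proof (rule array_ext)
      fix xs l
      have t: "entry (?t k \<mu>) xs l
          = (if xs = [] \<and> l = k then Poly_Mapping.single \<mu> (Poly_Mapping.lookup (entry e [] k) \<mu>) else 0)" for k \<mu>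
        by (simp add: const_def mult_single)
      show "entry e xs l = entry (\<Sum>k<m. \<Sum>\<mu>\<in>mons N (i - s k). ?t k \<mu>) xs l"
      proof (cases "xs = [] \<and> l < m")
        case True
        have "entry e [] l \<in> homogeneous N (i - s l)"
          using e part unfolding hpart_homogeneous by (auto simp: hom_component_def free_part_def)
        then have "entry e xs l = (\<Sum>\<mu>\<in>mons N (i - s l).
            Poly_Mapping.single \<mu> (Poly_Mapping.lookup (entry e [] l) \<mu>))"
          using True poly_mapping_sum_superset[OF finite_mons] by (simp add: homogeneous_keys)
        also have "\<dots> = (\<Sum>k<m. if l = k then (\<Sum>\<mu>\<in>mons N (i - s k).
            Poly_Mapping.single \<mu> (Poly_Mapping.lookup (entry e [] k) \<mu>)) else 0)"
          using True by (simp add: sum.delta)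
        also have "\<dots> = (\<Sum>k<m. \<Sum>\<mu>\<in>mons N (i - s k). entry (?t k \<mu>) xs l)"
          unfolding t using True by (intro sum.cong) auto
        finally show ?thesis by (simp only: entry_sum)
      next
        case False
        then have "entry e xs l = 0" using e by (auto simp: hom_component_def free_part_def)
        moreover have "(\<Sum>k<m. \<Sum>\<mu>\<in>mons N (i - s k). entry (?t k \<mu>) xs l) = 0"
          unfolding t using False by (intro sum.neutral ballI) auto
        ultimately show ?thesis by (simp only: entry_sum)
      qed
    qed
    also have "\<dots> \<in> arr.span ?B"
      by (intro arr.span_sum arr.span_scale arr.span_base) force
    finally show "e \<in> arr.span ?B" .
  qed
  moreover have "finite ?B" using finite_mons by (intro finite_imageI finite_SigmaI) auto
  ultimately show ?thesis unfolding arr.findim_def by blast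
qed

section \<open>Presenting a graded module by homogeneous generators\<close>

locale homogeneous_generators = U: Module.module "poly_ring N" U
  for N and U :: "('k::field polynomial, 'b) graded_module" +
  fixes m :: nat and g :: "nat \<Rightarrow> 'b" and s :: "nat \<Rightarrow> int"
  assumes graded_U: "is_graded_module N U"
    and g_component: "k < m \<Longrightarrow> g k \<in> component U (s k)"
    and g_span: "LinearCombinations.module.span (poly_ring N) U (g ` {..<m}) = carrier U"
begin

abbreviation "M \<equiv> free_part N m :: 'k array set"

definition \<pi> :: "'k array \<Rightarrow> 'b"
  where "\<pi> e = (\<Oplus>\<^bsub>U\<^esub>k\<in>{..<m}. entry e [] k \<odot>\<^bsub>U\<^esub> g k)"

lemma component_subgroup: "additive_subgroup (component U i) U"
  using graded_U by (simp add: is_graded_module_def)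

lemma component_carrier: "u \<in> component U i \<Longrightarrow> u \<in> carrier U"
  using additive_subgroup.a_Hcarr[OF component_subgroup] .

lemma g_carrier: "k < m \<Longrightarrow> g k \<in> carrier U"
  using g_component component_carrier by blast

lemma entry_carrier: "e \<in> M \<Longrightarrow> entry e xs k \<in> carrier (poly_ring N)"
  by (simp add: free_part_def)

lemma \<pi>_carrier: "e \<in> M \<Longrightarrow> \<pi> e \<in> carrier U"
  unfolding \<pi>_def by (intro U.M.finsum_closed) (auto simp: entry_carrier g_carrier)

lemma \<pi>_add: "e \<in> M \<Longrightarrow> e' \<in> M \<Longrightarrow> \<pi> (e + e') = \<pi> e \<oplus>\<^bsub>U\<^esub> \<pi> e'"
proof -
  assume e: "e \<in> M" "e' \<in> M"
  have "\<pi> (e + e') = (\<Oplus>\<^bsub>U\<^esub>k\<in>{..<m}. entry e [] k \<odot>\<^bsub>U\<^esub> g k \<oplus>\<^bsub>U\<^esub> entry e' [] k \<odot>\<^bsub>U\<^esub> g k)"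
    unfolding \<pi>_def using e U.smult_l_distr[OF entry_carrier entry_carrier g_carrier]
    by (intro U.M.finsum_cong') (auto simp: entry_carrier g_carrier)
  then show ?thesis
    unfolding \<pi>_def using e by (subst (asm) U.M.finsum_addf) (auto simp: entry_carrier g_carrier)
qed

lemma \<pi>_act: "e \<in> M \<Longrightarrow> p \<in> carrier (poly_ring N) \<Longrightarrow> \<pi> (act p e) = p \<odot>\<^bsub>U\<^esub> \<pi> e"
proof -
  assume e: "e \<in> M" "p \<in> carrier (poly_ring N)"
  have "\<pi> (act p e) = (\<Oplus>\<^bsub>U\<^esub>k\<in>{..<m}. p \<odot>\<^bsub>U\<^esub> (entry e [] k \<odot>\<^bsub>U\<^esub> g k))"
    unfolding \<pi>_def using e U.smult_assoc1[OF e(2) entry_carrier g_carrier]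
    by (intro U.M.finsum_cong') (auto simp: entry_carrier g_carrier)
  then show ?thesis
    unfolding \<pi>_def using e by (subst U.finsum_smult_ldistr) (auto simp: entry_carrier g_carrier)
qed

lemma \<pi>_zero: "\<pi> 0 = \<zero>\<^bsub>U\<^esub>"
proof -
  have "\<pi> 0 = (\<Oplus>\<^bsub>U\<^esub>k\<in>{..<m}. \<zero>\<^bsub>U\<^esub>)"
    unfolding \<pi>_def using U.smult_l_null[OF g_carrier] by (intro U.M.finsum_cong') auto
  then show ?thesis by simp
qed

lemma \<pi>_sum: "finite I \<Longrightarrow> (\<And>i. i \<in> I \<Longrightarrow> f i \<in> M) \<Longrightarrow> \<pi> (\<Sum>i\<in>I. f i) = (\<Oplus>\<^bsub>U\<^esub>i\<in>I. \<pi> (f i))"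
proof (induction I rule: finite_induct)
  case empty
  then show ?case by (simp add: \<pi>_zero)
next
  case (insert i I)
  have "(\<Sum>i\<in>I. f i) \<in> M" using insert.prems by (intro submod_sum[OF submod_free_part]) auto
  then show ?case
    using insert \<pi>_carrier by (subst U.M.finsum_insert) (auto simp: \<pi>_add)
qed

text \<open>The image is a submodule containing every generator.\<close>

lemma \<pi>_image: "\<pi> ` M = carrier U"
proof
  show "\<pi> ` M \<subseteq> carrier U" using \<pi>_carrier by blast
  have "LinearCombinations.submodule (poly_ring N) (\<pi> ` M) U"
    unfolding submodule_def
  proof (intro conjI allI impI)
    show "Module.module (poly_ring N) U" by (rule U.module_axioms)
    show "\<pi> ` M \<subseteq> carrier U" by fact
    show "\<zero>\<^bsub>U\<^esub> \<in> \<pi> ` M" using \<pi>_zero submodD(1)[OF submod_free_part] by (metis image_eqI)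
    fix v w assume "v \<in> \<pi> ` M" "w \<in> \<pi> ` M"
    then obtain e e' where e: "v = \<pi> e" "w = \<pi> e'" "e \<in> M" "e' \<in> M" by blast
    show "v \<oplus>\<^bsub>U\<^esub> w \<in> \<pi> ` M"
      unfolding e(1,2) \<pi>_add[OF e(3,4), symmetric]
      by (rule imageI, rule submodD(2)[OF submod_free_part e(3,4)])
  next
    fix c :: "'k polynomial" and v assume c: "c \<in> carrier (poly_ring N)" and "v \<in> \<pi> ` M"
    then obtain e where e: "v = \<pi> e" "e \<in> M" by blast
    show "c \<odot>\<^bsub>U\<^esub> v \<in> \<pi> ` M"
      unfolding e(1) \<pi>_act[OF e(2) c, symmetric]
      by (rule imageI, rule submodD(4)[OF submod_free_part c e(2)])
  qed
  moreover have "g ` {..<m} \<subseteq> \<pi> ` M"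
  proof (intro image_subsetI)
    fix k assume k: "k \<in> {..<m}"
    have u: "unit_array k 1 \<in> M" using k by (auto simp: free_part_def)
    have "\<pi> (unit_array k 1) = (\<Oplus>\<^bsub>U\<^esub>l\<in>{..<m}. if k = l then g l else \<zero>\<^bsub>U\<^esub>)"
      unfolding \<pi>_def using U.smult_l_null[OF g_carrier] U.smult_one[OF g_carrier]
      by (intro U.M.finsum_cong') (auto simp: g_carrier)
    also have "\<dots> = g k"
      using k by (intro U.M.finsum_singleton) (auto simp: g_carrier)
    finally show "g k \<in> \<pi> ` M" using u by (metis image_eqI)
  qed
  ultimately show "carrier U \<subseteq> \<pi> ` M"
    using U.span_is_subset[of "g ` {..<m}" "\<pi> ` M"] g_span by simp
qed

lemma part_in: "e \<in> M \<Longrightarrow> part s i e \<in> M"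
  using graded_free_part unfolding graded_def by blast

lemma finsum_component: "(\<And>k. k \<in> I \<Longrightarrow> f k \<in> component U i) \<Longrightarrow> finsum U f I \<in> component U i"
proof (induction I rule: infinite_finite_induct)
  case (insert k I)
  have "f \<in> I \<rightarrow> carrier U" "f k \<in> carrier U" using insert.prems component_carrier by blast+
  from U.M.finsum_insert[OF insert.hyps this] show ?case
    using additive_subgroup.a_closed[OF component_subgroup] insert by simp
qed (simp_all add: additive_subgroup.zero_closed[OF component_subgroup])

lemma \<pi>_part_component: "e \<in> M \<Longrightarrow> \<pi> (part s i e) \<in> component U i"
  unfolding \<pi>_def
proof (rule finsum_component)
  fix k assume e: "e \<in> M" and k: "k \<in> {..<m}"
  have "hpart (i - s k) (entry e [] k) \<in> homogeneous N (i - s k)"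
    by (simp add: hpart_homogeneous hpart_carrier entry_carrier[OF e])
  then have "hpart (i - s k) (entry e [] k) \<odot>\<^bsub>U\<^esub> g k \<in> component U (i - s k + s k)"
    using graded_U g_component[of k] k unfolding is_graded_module_def by blast
  then show "entry (part s i e) [] k \<odot>\<^bsub>U\<^esub> g k \<in> component U i" by simp
qed

lemma sum_part:
  assumes "e \<in> M"
  shows "\<exists>I. finite I \<and> e = (\<Sum>i\<in>I. part s i e) \<and> (\<forall>i. i \<notin> I \<longrightarrow> part s i e = 0)"
proof (intro exI conjI allI impI)
  \<comment> \<open>The degrees of all monomials occurring in \<open>e\<close>, each shifted by the
    degree of its generator.\<close>
  let ?I = "\<Union>k\<in>{..<m}. (\<lambda>\<mu>. int (mon_deg \<mu>) + s k) ` Poly_Mapping.keys (entry e [] k)"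
  show fin: "finite ?I" by auto
  show out: "part s i e = 0" if "i \<notin> ?I" for i
  proof (rule array_ext)
    fix xs k
    have "hpart (i - s k) (entry e xs k) = 0" if "xs = []" "k < m"
    proof (rule poly_mapping_eqI)
      fix \<mu> show "Poly_Mapping.lookup (hpart (i - s k) (entry e xs k)) \<mu> = Poly_Mapping.lookup 0 \<mu>"
        using that \<open>i \<notin> ?I\<close> by (force simp: lookup_hpart in_keys_iff)
    qed
    moreover have "entry e xs k = 0" if "\<not> (xs = [] \<and> k < m)" using assms that by (auto simp: free_part_def)
    ultimately show "entry (part s i e) xs k = entry 0 xs k" by (cases "xs = [] \<and> k < m") auto
  qed
  show "e = (\<Sum>i\<in>?I. part s i e)"
  proof (rule array_ext)
    fix xs k
    show "entry e xs k = entry (\<Sum>i\<in>?I. part s i e) xs k"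
    proof (cases "xs = [] \<and> k < m")
      case False
      then have "entry e xs k = 0" using assms by (auto simp: free_part_def)
      then show ?thesis by (simp add: entry_sum)
    next
      case True
      show ?thesis
      proof (rule poly_mapping_eqI)
        fix \<mu>
        have "(\<Sum>i\<in>?I. Poly_Mapping.lookup (hpart (i - s k) (entry e xs k)) \<mu>)
            = (\<Sum>i\<in>?I. if i = int (mon_deg \<mu>) + s k then Poly_Mapping.lookup (entry e xs k) \<mu> else 0)"
          by (intro sum.cong) (auto simp: lookup_hpart)
        also have "\<dots> = Poly_Mapping.lookup (entry e xs k) \<mu>"
          using True fin by (force simp: sum.delta in_keys_iff)
        finally show "Poly_Mapping.lookup (entry e xs k) \<mu> = Poly_Mapping.lookup (entry (\<Sum>i\<in>?I. part s i e) xs k) \<mu>"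
          by (simp add: entry_sum lookup_sum)
      qed
    qed
  qed
qed

definition decomposes :: "'b \<Rightarrow> (int \<Rightarrow> 'b) \<Rightarrow> bool"
  where "decomposes u c \<longleftrightarrow> (\<forall>i. c i \<in> component U i) \<and> finite {i. c i \<noteq> \<zero>\<^bsub>U\<^esub>} \<and>
        u = finsum U c {i. c i \<noteq> \<zero>\<^bsub>U\<^esub>}"

lemma decomposes_unique: "u \<in> carrier U \<Longrightarrow> decomposes u c \<Longrightarrow> decomposes u c' \<Longrightarrow> c = c'"
  using graded_U unfolding is_graded_module_def decomposes_def by blast

lemma decomposes_\<pi>: "e \<in> M \<Longrightarrow> decomposes (\<pi> e) (\<lambda>i. \<pi> (part s i e))"
proof -
  assume e: "e \<in> M"
  obtain I where I: "finite I" "e = (\<Sum>i\<in>I. part s i e)" "\<And>i. i \<notin> I \<Longrightarrow> part s i e = 0"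
    using sum_part[OF e] by blast
  \<comment> \<open>The inclusion can be strict, since \<open>\<pi>\<close> may kill nonzero parts;
    \<open>decomposes\<close> sums over the exact support.\<close>
  have sub: "{i. \<pi> (part s i e) \<noteq> \<zero>\<^bsub>U\<^esub>} \<subseteq> I"
    using I(3) \<pi>_zero by (metis (mono_tags, lifting) mem_Collect_eq subsetI)
  have "\<pi> e = \<pi> (\<Sum>i\<in>I. part s i e)" using I(2) by (rule arg_cong)
  also have "\<dots> = (\<Oplus>\<^bsub>U\<^esub>i\<in>I. \<pi> (part s i e))"
    by (rule \<pi>_sum[OF I(1) part_in[OF e]])
  also have "\<dots> = (\<Oplus>\<^bsub>U\<^esub>i\<in>{i. \<pi> (part s i e) \<noteq> \<zero>\<^bsub>U\<^esub>}. \<pi> (part s i e))"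
    using I(1) sub \<pi>_carrier[OF part_in[OF e]]
    by (intro U.M.add.finprod_mono_neutral_cong_right) auto
  finally show ?thesis
    unfolding decomposes_def using \<pi>_part_component[OF e] finite_subset[OF sub I(1)] by blast
qed

lemma decomposes_component:
  assumes "u \<in> component U i"
  shows "decomposes u (\<lambda>j. if j = i then u else \<zero>\<^bsub>U\<^esub>)"
proof -
  have "{j. (if j = i then u else \<zero>\<^bsub>U\<^esub>) \<noteq> \<zero>\<^bsub>U\<^esub>} = (if u = \<zero>\<^bsub>U\<^esub> then {} else {i})" by auto
  then show ?thesis
    unfolding decomposes_def using assms additive_subgroup.zero_closed[OF component_subgroup]
      component_carrier by auto
qed

text \<open>The parts of \<open>e\<close> and the trivial one-term family both decompose
  \<open>\<pi> e\<close>, so uniqueness of the homogeneous decomposition identifies them.\<close>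

lemma \<pi>_part_of_component:
  assumes "e \<in> M" "\<pi> e \<in> component U i"
  shows "\<pi> (part s j e) = (if j = i then \<pi> e else \<zero>\<^bsub>U\<^esub>)"
  using decomposes_unique[OF \<pi>_carrier[OF assms(1)] decomposes_\<pi>[OF assms(1)]
      decomposes_component[OF assms(2)]] by (rule fun_cong)

text \<open>The relations upstairs that present the quotient of \<open>U\<close> by
  \<open>T\<close>; this turns quotients of \<open>U\<close> into subquotients of arrays.\<close>

definition rel :: "'b set \<Rightarrow> 'k array set"
  where "rel T = {e \<in> M. \<pi> e \<in> T}"

lemma submod_rel:
  assumes "LinearCombinations.submodule (poly_ring N) T U"
  shows "submod N (rel T)"
  unfolding submod_def
proof (intro conjI ballI)
  note T = assms[unfolded submodule_def]
  show "0 \<in> rel T" using T \<pi>_zero submodD(1)[OF submod_free_part] by (auto simp: rel_def)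
  fix u v assume "u \<in> rel T" "v \<in> rel T"
  then show "u + v \<in> rel T"
    using T submodD(2)[OF submod_free_part, of u N m v] by (auto simp: rel_def \<pi>_add)
next
  note T = assms[unfolded submodule_def]
  fix p :: "'k polynomial" and u assume "p \<in> carrier (poly_ring N)" "u \<in> rel T"
  then show "act p u \<in> rel T"
    using T submodD(4)[OF submod_free_part, of p N u m] by (auto simp: rel_def \<pi>_act)
qed

lemma submodule_zero: "LinearCombinations.submodule (poly_ring N) {\<zero>\<^bsub>U\<^esub>} U"
  unfolding submodule_def using U.module_axioms by auto

text \<open>Zero lies in every component, so by uniqueness of decompositions all parts of a relation
  are again relations.\<close>

lemma presentation_rel: "presentation N s M (rel {\<zero>\<^bsub>U\<^esub>})"
proof -
  have "graded s (rel {\<zero>\<^bsub>U\<^esub>})"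
    unfolding graded_def
  proof (intro allI ballI)
    fix i u assume "u \<in> rel {\<zero>\<^bsub>U\<^esub>}"
    then have u: "u \<in> M" "\<pi> u = \<zero>\<^bsub>U\<^esub>" by (auto simp: rel_def)
    then have "\<pi> u \<in> component U i" using additive_subgroup.zero_closed[OF component_subgroup] by simp
    from \<pi>_part_of_component[OF u(1) this, of i] show "part s i u \<in> rel {\<zero>\<^bsub>U\<^esub>}"
      using u part_in[OF u(1)] by (simp add: rel_def)
  qed
  then show ?thesis
    unfolding presentation_def
    using submod_free_part submod_rel[OF submodule_zero] graded_free_part findim_free_part
    by (auto simp: rel_def)
qed

text \<open>Rank and nullity for \<open>\<pi>\<close> restricted to degree \<open>i\<close>, where
  its image is the component of \<open>U\<close> and its kernel is the degree-\<open>i\<close> part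
  of the relations.\<close>

lemma quotient_dim_rel: "quotient_dim s M (rel {\<zero>\<^bsub>U\<^esub>}) i = int (hilbert_series U i)"
proof -
  have sub: "arr.subspace (hom_component s i M)"
    by (intro subspace_comp submod_subspace) (rule submod_free_part)
  have "\<pi> ` hom_component s i M = component U i"
  proof (intro equalityI subsetI)
    fix u assume "u \<in> \<pi> ` hom_component s i M"
    then obtain e where e: "u = \<pi> e" "e \<in> M" "part s i e = e" by (auto simp: hom_component_def)
    then show "u \<in> component U i" using \<pi>_part_component[OF e(2), of i] by simp
  next
    fix u assume u: "u \<in> component U i"
    then obtain e where e: "u = \<pi> e" "e \<in> M" using component_carrier \<pi>_image by blast
    then have "u = \<pi> (part s i e)" using \<pi>_part_of_component[OF e(2), of i i] u by simp
    moreover have "part s i e \<in> hom_component s i M" using part_in[OF e(2)] by (simp add: hom_component_def)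
    ultimately show "u \<in> \<pi> ` hom_component s i M" by blast
  qed
  moreover have "{x \<in> hom_component s i M. \<pi> x = \<zero>\<^bsub>U\<^esub>} = hom_component s i (rel {\<zero>\<^bsub>U\<^esub>})"
    by (auto simp: hom_component_def rel_def)
  moreover have "x \<in> M" if "x \<in> hom_component s i M" for x using that by (simp add: hom_component_def)
  ultimately have "hilbert_series U i + arr.dim (hom_component s i (rel {\<zero>\<^bsub>U\<^esub>})) = arr.dim (hom_component s i M)"
    unfolding hilbert_series_def
    using arr.dim_vectorspace_image[OF sub, of \<pi> "component_space U i"] findim_free_part[of s i N m]
      \<pi>_add \<pi>_act[OF _ poly_ring_closed(3)] \<pi>_zero
    by (simp add: component_space_def)
  then show ?thesis by (simp add: quotient_dim_def)
qed

end

section \<open>Regular sequences along the presentation\<close>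

lemma weakly_regular_take: "weakly_regular M W fs \<Longrightarrow> weakly_regular M W (take d fs)"
proof (induction fs arbitrary: W d)
  case (Cons f fs)
  then show ?case by (cases d) auto
qed simp

context homogeneous_generators
begin

definition gens :: "'k polynomial list \<Rightarrow> 'b set"
  where "gens fs = {f \<odot>\<^bsub>U\<^esub> u | f u. f \<in> set fs \<and> u \<in> carrier U}"

lemma seq_submodule_eq: "seq_submodule N U fs = U.span (gens fs)"
  by (simp add: seq_submodule_def gens_def)

lemma gens_carrier: "set fs \<subseteq> carrier (poly_ring N) \<Longrightarrow> gens fs \<subseteq> carrier U"
  unfolding gens_def using U.smult_closed by blast

lemma submodule_seq:
  "set fs \<subseteq> carrier (poly_ring N) \<Longrightarrow> LinearCombinations.submodule (poly_ring N) (seq_submodule N U fs) U"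
  unfolding seq_submodule_eq by (rule U.span_is_submodule[OF gens_carrier])

text \<open>The explicit sums form a submodule containing all generators of the left side, and each
  summand lies in the left side.\<close>

lemma seq_submodule_snoc:
  assumes fs: "set fs \<subseteq> carrier (poly_ring N)" and f: "f \<in> carrier (poly_ring N)"
  shows "seq_submodule N U (fs @ [f]) = {v \<oplus>\<^bsub>U\<^esub> f \<odot>\<^bsub>U\<^esub> u | v u. v \<in> seq_submodule N U fs \<and> u \<in> carrier U}"
    (is "?L = ?R")
proof
  note S = submodule_seq[OF fs]
  have Sc: "v \<in> carrier U" if "v \<in> seq_submodule N U fs" for v
    using S that unfolding submodule_def by blast
  have S0: "\<zero>\<^bsub>U\<^esub> \<in> seq_submodule N U fs" using S unfolding submodule_def by blast
  have fc: "f \<odot>\<^bsub>U\<^esub> u \<in> carrier U" if "u \<in> carrier U" for u using U.smult_closed[OF f that] .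
  have "LinearCombinations.submodule (poly_ring N) ?R U"
    unfolding submodule_def
  proof (intro conjI allI impI)
    show "Module.module (poly_ring N) U" by (rule U.module_axioms)
    show "?R \<subseteq> carrier U" using Sc fc by auto
    show "\<zero>\<^bsub>U\<^esub> \<in> ?R"
      using S0 f by (intro CollectI exI[of _ "\<zero>\<^bsub>U\<^esub>"]) auto
    fix v w assume "v \<in> ?R" "w \<in> ?R"
    then obtain a b c d where ab: "v = a \<oplus>\<^bsub>U\<^esub> f \<odot>\<^bsub>U\<^esub> b" "w = c \<oplus>\<^bsub>U\<^esub> f \<odot>\<^bsub>U\<^esub> d"
      and mem: "a \<in> seq_submodule N U fs" "b \<in> carrier U" "c \<in> seq_submodule N U fs" "d \<in> carrier U"
      by blast
    have "v \<oplus>\<^bsub>U\<^esub> w = (a \<oplus>\<^bsub>U\<^esub> c) \<oplus>\<^bsub>U\<^esub> f \<odot>\<^bsub>U\<^esub> (b \<oplus>\<^bsub>U\<^esub> d)"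
      unfolding ab using Sc[OF mem(1)] Sc[OF mem(3)] mem(2,4) fc f
      by (simp add: U.smult_r_distr U.M.a_ac)
    moreover have "a \<oplus>\<^bsub>U\<^esub> c \<in> seq_submodule N U fs"
      using S mem(1,3) unfolding submodule_def by blast
    ultimately show "v \<oplus>\<^bsub>U\<^esub> w \<in> ?R" using mem(2,4) U.M.a_closed by blast
  next
    fix p :: "'k polynomial" and v assume p: "p \<in> carrier (poly_ring N)" and "v \<in> ?R"
    then obtain a b where ab: "v = a \<oplus>\<^bsub>U\<^esub> f \<odot>\<^bsub>U\<^esub> b"
      and mem: "a \<in> seq_submodule N U fs" "b \<in> carrier U" by blast
    have "p \<odot>\<^bsub>U\<^esub> v = p \<odot>\<^bsub>U\<^esub> a \<oplus>\<^bsub>U\<^esub> p \<odot>\<^bsub>U\<^esub> (f \<odot>\<^bsub>U\<^esub> b)"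
      unfolding ab using U.smult_r_distr[OF p Sc[OF mem(1)] fc[OF mem(2)]] .
    also have "p \<odot>\<^bsub>U\<^esub> (f \<odot>\<^bsub>U\<^esub> b) = f \<odot>\<^bsub>U\<^esub> (p \<odot>\<^bsub>U\<^esub> b)"
      using U.smult_assoc1[OF p f mem(2)] U.smult_assoc1[OF f p mem(2)] by (simp add: mult.commute)
    finally have "p \<odot>\<^bsub>U\<^esub> v = p \<odot>\<^bsub>U\<^esub> a \<oplus>\<^bsub>U\<^esub> f \<odot>\<^bsub>U\<^esub> (p \<odot>\<^bsub>U\<^esub> b)" .
    moreover have "p \<odot>\<^bsub>U\<^esub> a \<in> seq_submodule N U fs"
      using S mem(1) p unfolding submodule_def by blast
    ultimately show "p \<odot>\<^bsub>U\<^esub> v \<in> ?R" using U.smult_closed[OF p mem(2)] by blast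
  qed
  moreover have "gens (fs @ [f]) \<subseteq> ?R"
  proof
    fix w assume "w \<in> gens (fs @ [f])"
    then obtain f' u where w: "w = f' \<odot>\<^bsub>U\<^esub> u" "u \<in> carrier U" and "f' \<in> set fs \<or> f' = f"
      by (auto simp: gens_def)
    then show "w \<in> ?R"
    proof (elim disjE)
      assume "f' \<in> set fs"
      then have "w \<in> seq_submodule N U fs"
        using U.in_own_span[OF gens_carrier[OF fs]] w unfolding seq_submodule_eq gens_def by blast
      moreover have "w = w \<oplus>\<^bsub>U\<^esub> f \<odot>\<^bsub>U\<^esub> \<zero>\<^bsub>U\<^esub>" using Sc[OF calculation] f by simp
      ultimately show ?thesis using U.M.zero_closed by blast
    next
      assume "f' = f"
      then have "w = \<zero>\<^bsub>U\<^esub> \<oplus>\<^bsub>U\<^esub> f \<odot>\<^bsub>U\<^esub> u" using w fc by simp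
      then show ?thesis using S0 w(2) by blast
    qed
  qed
  ultimately show "?L \<subseteq> ?R"
    unfolding seq_submodule_eq[of "fs @ [f]"] by (intro U.span_is_subset)
  show "?R \<subseteq> ?L"
  proof
    have set: "set (fs @ [f]) \<subseteq> carrier (poly_ring N)" using fs f by simp
    fix w assume "w \<in> ?R"
    then obtain v u where w: "w = v \<oplus>\<^bsub>U\<^esub> f \<odot>\<^bsub>U\<^esub> u" "v \<in> seq_submodule N U fs" "u \<in> carrier U" by blast
    have "gens fs \<subseteq> gens (fs @ [f])" by (auto simp: gens_def)
    then have "v \<in> ?L" using w(2) U.span_is_monotone unfolding seq_submodule_eq by blast
    moreover have "f \<odot>\<^bsub>U\<^esub> u \<in> ?L"
      using U.in_own_span[OF gens_carrier[OF set]] w(3) unfolding seq_submodule_eq gens_def by auto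
    ultimately show "w \<in> ?L"
      using submodule_seq[OF set] unfolding submodule_def w(1) by blast
  qed
qed

text \<open>Surjectivity of \<open>\<pi>\<close> lifts \<open>u\<close> to some \<open>x\<close>;
  subtracting \<open>act f x\<close> from a relation leaves one for the shorter sequence.\<close>

lemma rel_seq_submodule_snoc:
  assumes fs: "set fs \<subseteq> carrier (poly_ring N)" and f: "f \<in> carrier (poly_ring N)"
  shows "rel (seq_submodule N U (fs @ [f])) = add_act (rel (seq_submodule N U fs)) f M"
proof (intro equalityI subsetI)
  have Sc: "v \<in> carrier U" if "v \<in> seq_submodule N U fs" for v
    using submodule_seq[OF fs] that unfolding submodule_def by blast
  fix e assume "e \<in> rel (seq_submodule N U (fs @ [f]))"
  then obtain v u where e: "e \<in> M" "\<pi> e = v \<oplus>\<^bsub>U\<^esub> f \<odot>\<^bsub>U\<^esub> u"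
    and vu: "v \<in> seq_submodule N U fs" "u \<in> carrier U"
    unfolding rel_def seq_submodule_snoc[OF fs f] by blast
  obtain x where x: "u = \<pi> x" "x \<in> M" using vu(2) \<pi>_image by blast
  let ?w = "e - act f x"
  have fx: "act f x \<in> M" using submodD(4)[OF submod_free_part f x(2)] .
  then have w: "?w \<in> M" using submodD(3)[OF submod_free_part e(1)] by blast
  have "\<pi> ?w \<oplus>\<^bsub>U\<^esub> \<pi> (act f x) = \<pi> e" using \<pi>_add[OF w fx] by simp
  also have "\<dots> = v \<oplus>\<^bsub>U\<^esub> \<pi> (act f x)" using e(2) x \<pi>_act[OF x(2) f] by simp
  finally have "\<pi> ?w = v"
    using U.M.add.right_cancel[OF \<pi>_carrier[OF fx] \<pi>_carrier[OF w] Sc[OF vu(1)]] by blast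
  then have "?w \<in> rel (seq_submodule N U fs)" using w vu(1) by (simp add: rel_def)
  moreover have "e = ?w + act f x" by simp
  ultimately show "e \<in> add_act (rel (seq_submodule N U fs)) f M"
    unfolding add_act_def using x(2) by blast
next
  fix e assume "e \<in> add_act (rel (seq_submodule N U fs)) f M"
  then obtain w x where e: "e = w + act f x" "w \<in> M" "\<pi> w \<in> seq_submodule N U fs" "x \<in> M"
    unfolding add_act_def rel_def by blast
  have fx: "act f x \<in> M" using submodD(4)[OF submod_free_part f e(4)] .
  have "\<pi> e = \<pi> w \<oplus>\<^bsub>U\<^esub> f \<odot>\<^bsub>U\<^esub> \<pi> x"
    unfolding e(1) \<pi>_add[OF e(2) fx] \<pi>_act[OF e(4) f] ..
  moreover have "e \<in> M" unfolding e(1) using submodD(2)[OF submod_free_part e(2) fx] .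
  ultimately show "e \<in> rel (seq_submodule N U (fs @ [f]))"
    unfolding rel_def seq_submodule_snoc[OF fs f] using e(3) \<pi>_carrier[OF e(4)] by blast
qed

text \<open>The prefix \<open>gs\<close> records the elements already divided out, so that the head
  of the remaining list is the entry of index \<open>length gs\<close> in the full sequence.\<close>

lemma weakly_regular_rel:
  "regular_sequence N U (gs @ fs) \<Longrightarrow> weakly_regular M (rel (seq_submodule N U gs)) fs"
proof (induction fs arbitrary: gs)
  case Nil
  then show ?case by simp
next
  case (Cons f fs)
  have carr: "set gs \<subseteq> carrier (poly_ring N)" "f \<in> carrier (poly_ring N)"
    using Cons.prems by (auto simp: regular_sequence_def)
  have regf: "u \<in> seq_submodule N U gs"
    if "u \<in> carrier U" "f \<odot>\<^bsub>U\<^esub> u \<in> seq_submodule N U gs" for u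
  proof -
    have "length gs < length (gs @ f # fs)" by simp
    with Cons.prems have "\<forall>u\<in>carrier U. (gs @ f # fs) ! length gs \<odot>\<^bsub>U\<^esub> u
        \<in> seq_submodule N U (take (length gs) (gs @ f # fs)) \<longrightarrow>
        u \<in> seq_submodule N U (take (length gs) (gs @ f # fs))"
      unfolding regular_sequence_def by blast
    then show ?thesis using that by simp
  qed
  have "u \<in> rel (seq_submodule N U gs)" if "u \<in> M" "act f u \<in> rel (seq_submodule N U gs)" for u
    using that regf[OF \<pi>_carrier] \<pi>_act[OF that(1) carr(2)] by (simp add: rel_def)
  moreover have "weakly_regular M (add_act (rel (seq_submodule N U gs)) f M) fs"
    using Cons.IH[of "gs @ [f]"] Cons.prems rel_seq_submodule_snoc[OF carr] by simp
  ultimately show ?case by simp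
qed

lemma seq_submodule_Nil: "seq_submodule N U [] = {\<zero>\<^bsub>U\<^esub>}"
proof -
  have "U.span {} = {\<zero>\<^bsub>U\<^esub>}"
    unfolding U.span_def U.lincomb_def by (auto simp: U.M.finsum_empty)
  then show ?thesis by (simp add: seq_submodule_eq gens_def)
qed

lemma difference_nonneg:
  assumes "N \<ge> 1" "set fs \<subseteq> irrelevant_ideal N" "regular_sequence N U fs" "d \<le> length fs"
  shows "0 \<le> (weighted_diff 1 1 ^^ d) (\<lambda>i. int (hilbert_series U i)) i"
proof -
  have "weakly_regular M (rel {\<zero>\<^bsub>U\<^esub>}) (take d fs)"
    using weakly_regular_rel[of "[]" fs] assms(3) by (intro weakly_regular_take) (simp add: seq_submodule_Nil)
  moreover have "set (take d fs) \<subseteq> irrelevant_ideal N" using assms(2) set_take_subset[of d fs] by blast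
  ultimately have "0 \<le> (weighted_diff 1 1 ^^ length (take d fs)) (quotient_dim s M (rel {\<zero>\<^bsub>U\<^esub>})) i"
    by (intro difference_quotient_dim_nonneg[OF assms(1) presentation_rel])
  moreover have "quotient_dim s M (rel {\<zero>\<^bsub>U\<^esub>}) = (\<lambda>i. int (hilbert_series U i))"
    by (rule ext) (rule quotient_dim_rel)
  ultimately show ?thesis using assms(4) by simp
qed

end

text \<open>The nonzero homogeneous components of a finite generating set are finite in number and
  generate the same module.\<close>

lemma ex_homogeneous_generators:
  assumes gr: "is_graded_module N U" and fg: "finitely_generated N (U :: ('k::field polynomial, 'b) graded_module)"
  shows "\<exists>m g s. homogeneous_generators N U m g s"
proof -
  interpret U: Module.module "poly_ring N" U using gr by (simp add: is_graded_module_def)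
  obtain A where A: "finite A" "A \<subseteq> carrier U" "U.span A = carrier U"
    using fg by (auto simp: finitely_generated_def)
  have "\<forall>u\<in>A. \<exists>c. (\<forall>i. c i \<in> component U i) \<and> finite {i. c i \<noteq> \<zero>\<^bsub>U\<^esub>} \<and>
      u = finsum U c {i. c i \<noteq> \<zero>\<^bsub>U\<^esub>}"
    using gr A(2) unfolding is_graded_module_def by blast
  then obtain c where c: "\<And>u i. u \<in> A \<Longrightarrow> c u i \<in> component U i"
      "\<And>u. u \<in> A \<Longrightarrow> finite {i. c u i \<noteq> \<zero>\<^bsub>U\<^esub>}"
      "\<And>u. u \<in> A \<Longrightarrow> u = finsum U (c u) {i. c u i \<noteq> \<zero>\<^bsub>U\<^esub>}"
    unfolding bchoice_iff by blast
  \<comment> \<open>Components are stored together with their degrees, so one enumeration of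
    \<open>P\<close> supplies both \<open>g\<close> and \<open>s\<close>.\<close>
  define P where "P = (\<Union>u\<in>A. (\<lambda>i. (i, c u i)) ` {i. c u i \<noteq> \<zero>\<^bsub>U\<^esub>})"
  have "finite P" unfolding P_def using A(1) c(2) by (intro finite_UN_I finite_imageI)
  then obtain m and f :: "nat \<Rightarrow> int \<times> 'b" where f: "P = f ` {i. i < m}"
    using finite_imp_nat_seg_image_inj_on[OF \<open>finite P\<close>] by blast
  have mem: "f k \<in> P" if "k < m" for k using that unfolding f by blast
  have comp: "snd (f k) \<in> component U (fst (f k))" if k: "k < m" for k
  proof -
    obtain u i where "u \<in> A" "f k = (i, c u i)" using mem[OF k] unfolding P_def by blast
    then show ?thesis using c(1) by simp
  qed
  let ?G = "(\<lambda>k. snd (f k)) ` {..<m}"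
  have carr: "component U i \<subseteq> carrier U" for i
    using gr additive_subgroup.a_subset unfolding is_graded_module_def by blast
  have G: "?G \<subseteq> carrier U" using comp carr by blast
  note S = U.span_is_submodule[OF G]
  have "A \<subseteq> U.span ?G"
  proof
    fix u assume u: "u \<in> A"
    have cS: "c u i \<in> U.span ?G" if "c u i \<noteq> \<zero>\<^bsub>U\<^esub>" for i
    proof -
      have "(i, c u i) \<in> f ` {i. i < m}" using u that unfolding f[symmetric] P_def by blast
      then obtain k where "k < m" "f k = (i, c u i)" by force
      then have "c u i \<in> ?G" by (metis imageI lessThan_iff snd_conv)
      then show ?thesis using U.in_own_span[OF G] by blast
    qed
    have sumS: "finsum U (c u) J \<in> U.span ?G" if "finite J" "J \<subseteq> {i. c u i \<noteq> \<zero>\<^bsub>U\<^esub>}" for J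
      using that
    proof (induction J rule: finite_induct)
      case empty
      then show ?case using S unfolding submodule_def by simp
    next
      case (insert j J)
      have "c u \<in> J \<rightarrow> carrier U" "c u j \<in> carrier U" using c(1)[OF u] carr by blast+
      from U.M.finsum_insert[OF insert.hyps this] show ?case
        using insert cS[of j] S unfolding submodule_def by simp
    qed
    show "u \<in> U.span ?G"
      by (subst c(3)[OF u]) (rule sumS[OF c(2)[OF u] order_refl])
  qed
  then have "U.span A \<subseteq> U.span ?G" by (rule U.span_is_subset[OF _ S])
  then have "U.span ?G = carrier U" using A(3) U.span_is_subset2[OF G] by blast
  then have "homogeneous_generators N U m (\<lambda>k. snd (f k)) (\<lambda>k. fst (f k))"
    using gr comp by unfold_locales auto
  then show ?thesis by blast
qed

lemma regular_sequence_difference_nonneg: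
  assumes "N \<ge> 1" "is_graded_module N U" "finitely_generated N U"
    and "set fs \<subseteq> irrelevant_ideal N" "regular_sequence N U fs" "d \<le> length fs"
  shows "0 \<le> (weighted_diff 1 1 ^^ d) (\<lambda>i. int (hilbert_series U i)) i"
proof -
  obtain m g s where "homogeneous_generators N U m g s"
    using ex_homogeneous_generators[OF assms(2,3)] by blast
  then interpret homogeneous_generators N U m g s .
  show ?thesis by (rule difference_nonneg[OF assms(1,4-6)])
qed

section \<open>The Hilbert function of the quotient\<close>

interpretation pol: linear_space "\<lambda>c p. const c * (p :: 'k::field polynomial)"
  by unfold_locales (auto simp: const_simps distrib_left distrib_right mult.assoc)

lemma const_mult_single: "const c * Poly_Mapping.single m 1 = Poly_Mapping.single m c"
  by (simp add: const_def mult_single)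

lemma keys_const_mult: "Poly_Mapping.keys (const c * p) \<subseteq> Poly_Mapping.keys p"
  using keys_mult[of "const c" p] by (auto simp: const_def split: if_splits)

text \<open>The monomials in \<open>T\<close> form a basis, coefficients being read off by
  \<open>lookup\<close>.\<close>

lemma polynomials_on:
  assumes "finite T"
  shows "pol.subspace {p :: 'k::field polynomial. Poly_Mapping.keys p \<subseteq> T}"
    and "pol.findim {p :: 'k polynomial. Poly_Mapping.keys p \<subseteq> T}"
    and "pol.dim {p :: 'k polynomial. Poly_Mapping.keys p \<subseteq> T} = card T"
proof -
  let ?V = "{p :: 'k polynomial. Poly_Mapping.keys p \<subseteq> T}"
  let ?s = "\<lambda>m. Poly_Mapping.single m 1 :: 'k polynomial"
  show sub: "pol.subspace ?V"
  proof (rule pol.subspaceI)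
    fix p q :: "'k polynomial" assume "p \<in> ?V" "q \<in> ?V"
    then show "p + q \<in> ?V" using Poly_Mapping.keys_add[of p q] by auto
  next
    fix c and p :: "'k polynomial" assume "p \<in> ?V"
    then show "const c * p \<in> ?V" using keys_const_mult[of c p] by auto
  qed simp
  have span: "?V \<subseteq> pol.span (?s ` T)"
  proof
    fix p :: "'k polynomial" assume "p \<in> ?V"
    then have "p = (\<Sum>m\<in>T. Poly_Mapping.single m (Poly_Mapping.lookup p m))"
      by (intro poly_mapping_sum_superset[OF assms]) simp
    also have "\<dots> = (\<Sum>m\<in>T. const (Poly_Mapping.lookup p m) * ?s m)"
      by (simp add: const_mult_single)
    also have "\<dots> \<in> pol.span (?s ` T)"
      by (intro pol.span_sum pol.span_scale pol.span_base imageI)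
    finally show "p \<in> pol.span (?s ` T)" .
  qed
  show "pol.findim ?V" unfolding pol.findim_def using span assms by blast
  have inj: "inj_on ?s T" by (rule inj_onI) (metis lookup_single_eq lookup_single_not_eq zero_neq_one)
  have ind: "pol.independent (?s ` T)"
  proof (rule pol.independent_if_scalars_zero)
    fix f x assume z: "(\<Sum>x\<in>?s ` T. const (f x) * x) = 0" and "x \<in> ?s ` T"
    then obtain m where m: "m \<in> T" "x = ?s m" by blast
    have "(\<Sum>x\<in>?s ` T. const (f x) * x) = (\<Sum>n\<in>T. Poly_Mapping.single n (f (?s n)))"
      using inj by (subst sum.reindex) (auto simp: const_mult_single)
    then have "0 = Poly_Mapping.lookup (\<Sum>n\<in>T. Poly_Mapping.single n (f (?s n))) m" using z by simp
    also have "\<dots> = (\<Sum>n\<in>T. if n = m then f (?s n) else 0)"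
      by (simp add: lookup_sum lookup_single when_def)
    also have "\<dots> = f x" using m assms by simp
    finally show "f x = 0" by simp
  qed (use assms in simp)
  have "pol.dim ?V = card (?s ` T)"
    using span ind by (intro pol.dim_unique) (auto split: if_splits)
  then show "pol.dim ?V = card T" using card_image[OF inj] by simp
qed

section \<open>The monomial ideal and its standard monomials\<close>

definition divisible :: "nat \<Rightarrow> nat \<Rightarrow> (nat \<Rightarrow>\<^sub>0 nat) \<Rightarrow> bool"
  where "divisible n r m \<longleftrightarrow> {1..r - 1} \<subseteq> Poly_Mapping.keys m \<and> (\<exists>i\<in>{r..n + r - 1}. i \<in> Poly_Mapping.keys m)"

definition core :: "nat \<Rightarrow> nat \<Rightarrow>\<^sub>0 nat"
  where "core r = (\<Sum>j\<in>{1..r - 1}. Poly_Mapping.single j 1)"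

lemma lookup_core: "Poly_Mapping.lookup (core r) j = (if j \<in> {1..r - 1} then 1 else 0)"
  by (auto simp: core_def lookup_sum lookup_single when_def)

lemma prod_X: "(\<Prod>j\<in>J. X j :: 'k::field polynomial) = Poly_Mapping.single (\<Sum>j\<in>J. Poly_Mapping.single j 1) 1"
  by (induction J rule: infinite_finite_induct) (auto simp: X_def mult_single)

lemma generator_eq:
  "(\<Prod>j\<in>{1..r - 1}. X j) * X i = (Poly_Mapping.single (core r + Poly_Mapping.single i 1) 1 :: 'k::field polynomial)"
  by (simp only: prod_X core_def[symmetric]) (simp add: X_def mult_single)

lemma divisible_add: "divisible n r m \<Longrightarrow> divisible n r (m + m')"
  by (auto simp: divisible_def in_keys_iff lookup_add)

text \<open>The generators are squarefree, so a condition on the support of \<open>m\<close>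
  suffices for one of them to divide \<open>m\<close>. This justifies the definition of
  \<open>divisible\<close>.\<close>

lemma divisible_split:
  assumes "divisible n r m" "r \<ge> 1"
  obtains i m' where "i \<in> {r..n + r - 1}" "m = (core r + Poly_Mapping.single i 1) + m'"
proof -
  obtain i where i: "i \<in> {r..n + r - 1}" "i \<in> Poly_Mapping.keys m" "{1..r - 1} \<subseteq> Poly_Mapping.keys m"
    using assms(1) by (auto simp: divisible_def)
  let ?c = "core r + Poly_Mapping.single i 1"
  have "Poly_Mapping.lookup ?c j \<le> Poly_Mapping.lookup m j" for j
    using i assms(2) by (auto simp: lookup_add lookup_core lookup_single when_def in_keys_iff subset_iff Suc_le_eq)
  then have "m = ?c + (m - ?c)"
    by (intro poly_mapping_eqI) (simp add: lookup_add lookup_minus)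
  then show ?thesis using that i(1) by blast
qed

text \<open>The right side is an ideal containing the generators. Conversely, every term of such a
  \<open>p\<close> is a multiple of a generator.\<close>

lemma I_ideal_eq:
  assumes "r \<ge> 1"
  shows "(I_ideal n r :: 'k::field polynomial set) =
    {p \<in> carrier (poly_ring (n + r - 1)). \<forall>m\<in>Poly_Mapping.keys p. divisible n r m}"
    (is "_ = ?J")
proof -
  let ?N = "n + r - 1"
  let ?gen = "{(\<Prod>j\<in>{1..r - 1}. X j) * X i | i. r \<le> i \<and> i \<le> r + n - 1} :: 'k polynomial set"
  have gen_carrier: "?gen \<subseteq> carrier (poly_ring ?N)"
  proof
    fix p assume "p \<in> ?gen"
    then obtain i where i: "p = Poly_Mapping.single (core r + Poly_Mapping.single i 1) 1" "r \<le> i" "i \<le> r + n - 1"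
      unfolding generator_eq by blast
    have "Poly_Mapping.keys (core r + Poly_Mapping.single i (1::nat)) \<subseteq> {1..?N}"
      using i assms by (auto simp: in_keys_iff lookup_add lookup_core lookup_single when_def split: if_splits)
    then show "p \<in> carrier (poly_ring ?N)" by (simp add: carrier_poly_ring i(1))
  qed
  have "ideal ?J (poly_ring ?N)"
  proof (rule idealI)
    show "subgroup ?J (add_monoid (poly_ring ?N))"
    proof (rule pr.add.subgroupI)
      fix a :: "'k polynomial" assume a: "a \<in> ?J"
      then have "\<ominus>\<^bsub>poly_ring ?N\<^esub> a = - a" by (intro pr.minus_equality) auto
      then show "\<ominus>\<^bsub>poly_ring ?N\<^esub> a \<in> ?J" using a by simp
    next
      fix a b :: "'k polynomial" assume "a \<in> ?J" "b \<in> ?J"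
      then show "a \<oplus>\<^bsub>poly_ring ?N\<^esub> b \<in> ?J"
        using Poly_Mapping.keys_add[of a b] by auto
    next
      have "0 \<in> ?J" by simp
      then show "?J \<noteq> {}" by blast
    qed auto
  next
    fix a x :: "'k polynomial" assume a: "a \<in> ?J" and x: "x \<in> carrier (poly_ring ?N)"
    have "divisible n r m" if m: "m \<in> Poly_Mapping.keys (a * x)" for m
    proof -
      obtain m1 m2 where "m = m1 + m2" "m1 \<in> Poly_Mapping.keys a"
        using m keys_mult[of a x] by blast
      then show ?thesis using a divisible_add by blast
    qed
    then show "a \<otimes>\<^bsub>poly_ring ?N\<^esub> x \<in> ?J" using a x by simp
    then show "x \<otimes>\<^bsub>poly_ring ?N\<^esub> a \<in> ?J" by (simp add: mult.commute)
  qed (rule pr.ring_axioms)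
  moreover have "?gen \<subseteq> ?J"
  proof
    fix p assume p: "p \<in> ?gen"
    then obtain i where i: "p = Poly_Mapping.single (core r + Poly_Mapping.single i 1) 1" "r \<le> i" "i \<le> r + n - 1"
      unfolding generator_eq by blast
    have "divisible n r (core r + Poly_Mapping.single i 1)"
      using i(2,3) by (auto simp: divisible_def in_keys_iff lookup_add lookup_core lookup_single when_def add.commute)
    then show "p \<in> ?J" using p gen_carrier i(1) by auto
  qed
  ultimately have "I_ideal n r \<subseteq> ?J"
    unfolding I_ideal_def by (rule pr.genideal_minimal)
  moreover have "?J \<subseteq> I_ideal n r"
  proof
    fix p :: "'k polynomial" assume p: "p \<in> ?J"
    have id: "ideal (I_ideal n r :: 'k polynomial set) (poly_ring ?N)"
      unfolding I_ideal_def by (rule pr.genideal_ideal[OF gen_carrier])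
    interpret I: ideal "I_ideal n r :: 'k polynomial set" "poly_ring ?N" by (rule id)
    have single: "Poly_Mapping.single m (Poly_Mapping.lookup p m) \<in> I_ideal n r" if m: "m \<in> Poly_Mapping.keys p" for m
    proof -
      have "divisible n r m" using p m by blast
      then obtain i m' where i: "i \<in> {r..n + r - 1}" "m = (core r + Poly_Mapping.single i 1) + m'"
        using divisible_split assms by blast
      have "Poly_Mapping.keys m' \<subseteq> Poly_Mapping.keys m"
        unfolding i(2) by (auto simp: in_keys_iff lookup_add)
      also have "\<dots> \<subseteq> {1..?N}" using p m by (auto simp: carrier_poly_ring)
      finally have "Poly_Mapping.single m' (Poly_Mapping.lookup p m) \<in> carrier (poly_ring ?N)"
        by (auto simp: carrier_poly_ring)
      moreover have "(\<Prod>j\<in>{1..r - 1}. X j) * X i \<in> (I_ideal n r :: 'k polynomial set)"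
        unfolding I_ideal_def by (rule subsetD[OF pr.genideal_self[OF gen_carrier]]) (use i(1) in auto)
      ultimately have "Poly_Mapping.single m' (Poly_Mapping.lookup p m) * ((\<Prod>j\<in>{1..r - 1}. X j) * X i)
          \<in> (I_ideal n r :: 'k polynomial set)"
        using I.I_l_closed by simp
      then show ?thesis unfolding generator_eq by (simp add: mult_single i(2) add.commute)
    qed
    have "(\<Sum>m\<in>S. Poly_Mapping.single m (Poly_Mapping.lookup p m)) \<in> I_ideal n r"
      if "finite S" "S \<subseteq> Poly_Mapping.keys p" for S
      using that
    proof (induction S rule: finite_induct)
      case empty
      then show ?case using I.zero_closed by simp
    next
      case (insert m S)
      then show ?case using I.a_closed[OF single[of m]] by simp
    qed
    from this[OF finite_keys order_refl] show "p \<in> I_ideal n r"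
      by (subst poly_mapping_sum_single)
  qed
  ultimately show ?thesis by blast
qed

definition standard_mons :: "nat \<Rightarrow> nat \<Rightarrow> int \<Rightarrow> (nat \<Rightarrow>\<^sub>0 nat) set"
  where "standard_mons n r i = {m \<in> mons (n + r - 1) i. \<not> divisible n r m}"

text \<open>The cosets of the standard monomials of degree \<open>i\<close> form a basis: dropping
  divisible monomials does not change a coset, and only 0 is both in the ideal and free of divisible
  monomials.\<close>

lemma hilbert_series_quotient:
  assumes "r \<ge> 1"
  shows "hilbert_series (quotient_module (n + r - 1) (I_ideal n r :: 'k::field polynomial set)) i
    = card (standard_mons n r i)"
proof -
  let ?N = "n + r - 1"
  let ?S = "poly_ring ?N :: 'k polynomial ring"
  let ?I = "I_ideal n r :: 'k polynomial set"
  let ?T = "standard_mons n r i"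
  let ?A = "{p :: 'k polynomial. Poly_Mapping.keys p \<subseteq> ?T}"
  let ?V = "component_space (quotient_module ?N ?I) i"
  let ?\<phi> = "\<lambda>p. ?I +>\<^bsub>?S\<^esub> p"
  have id: "ideal ?I ?S"
    unfolding I_ideal_def
  proof (rule pr.genideal_ideal, rule subsetI)
    fix p :: "'k polynomial" assume "p \<in> {(\<Prod>j\<in>{1..r - 1}. X j) * X i | i. r \<le> i \<and> i \<le> r + n - 1}"
    then obtain i where i: "p = Poly_Mapping.single (core r + Poly_Mapping.single i 1) 1" "r \<le> i" "i \<le> r + n - 1"
      unfolding generator_eq by blast
    have "Poly_Mapping.keys (core r + Poly_Mapping.single i (1::nat)) \<subseteq> {1..?N}"
      using i assms by (auto simp: in_keys_iff lookup_add lookup_core lookup_single when_def split: if_splits)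
    then show "p \<in> carrier ?S" by (simp add: carrier_poly_ring i(1))
  qed
  interpret I: ideal ?I ?S by (rule id)
  have finT: "finite ?T" unfolding standard_mons_def using finite_mons by simp
  have AH: "?A \<subseteq> homogeneous ?N i" by (auto simp: homogeneous_keys standard_mons_def)
  have HS: "homogeneous ?N i \<subseteq> carrier ?S" by (auto simp: homogeneous_def)
  have mem: "p \<in> carrier ?S" if "p \<in> ?A" for p using that AH HS by blast
  have coset_eq: "?\<phi> (q + p) = ?\<phi> p" if "p \<in> carrier ?S" "q \<in> ?I" for p q
    using pr.a_coset_add_assoc[OF I.a_subset I.a_Hcarr[OF that(2)] that(1)] I.a_rcos_const[OF that(2)]
    by simp
  have V: "carrier ?V = ?\<phi> ` homogeneous ?N i" "\<zero>\<^bsub>?V\<^esub> = ?I" "add ?V = set_add ?S"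
    "c \<odot>\<^bsub>?V\<^esub> C = rcoset_mult ?S ?I (?\<phi> (const c)) C" for c C
    by (auto simp: component_space_def quotient_module_def Let_def FactRing_def)
  have "?\<phi> ` ?A = carrier ?V"
    unfolding V
  proof (rule equalityI[OF image_mono[OF AH] image_subsetI])
    fix p :: "'k polynomial" assume p: "p \<in> homogeneous ?N i"
    \<comment> \<open>The normal form of \<open>p\<close>: its standard terms. The remaining terms
      are divisible and hence in the ideal.\<close>
    define a where "a = (\<Sum>m\<in>?T. Poly_Mapping.single m (Poly_Mapping.lookup p m))"
    have lookup_a: "Poly_Mapping.lookup a m = (if m \<in> ?T then Poly_Mapping.lookup p m else 0)" for m
      using finT by (simp add: a_def lookup_sum lookup_single when_def)
    have a: "a \<in> ?A" by (auto simp: in_keys_iff lookup_a split: if_splits)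
    have keys: "m \<in> Poly_Mapping.keys p \<and> m \<notin> ?T" if "m \<in> Poly_Mapping.keys (p - a)" for m
      using that by (auto simp: in_keys_iff lookup_minus lookup_a split: if_splits)
    have "p - a \<in> ?I"
      unfolding I_ideal_eq[OF assms]
    proof (intro CollectI conjI ballI)
      have "p \<in> carrier ?S" using p HS by blast
      then show "p - a \<in> carrier ?S" unfolding carrier_poly_ring using keys by blast
      fix m assume "m \<in> Poly_Mapping.keys (p - a)"
      then show "divisible n r m"
        using keys p by (auto simp: homogeneous_keys standard_mons_def)
    qed
    from coset_eq[OF mem[OF a] this] have "?\<phi> p = ?\<phi> a" by simp
    then show "?\<phi> p \<in> ?\<phi> ` ?A" using a by (rule image_eqI)
  qed
  moreover have "?\<phi> (p + q) = ?\<phi> p \<oplus>\<^bsub>?V\<^esub> ?\<phi> q" if "p \<in> ?A" "q \<in> ?A" for p q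
    unfolding V using I.a_rcos_sum[OF mem[OF that(1)] mem[OF that(2)]] by simp
  moreover have "?\<phi> (const c * p) = c \<odot>\<^bsub>?V\<^esub> ?\<phi> p" if "p \<in> ?A" for c p
    unfolding V using I.rcoset_mult_add[OF poly_ring_closed(3) mem[OF that]] by simp
  moreover have "?\<phi> 0 = \<zero>\<^bsub>?V\<^esub>"
    unfolding V using pr.a_coset_add_zero[OF I.a_subset] by simp
  ultimately have "vectorspace.dim (class_ring :: 'k ring) ?V + pol.dim {p \<in> ?A. ?\<phi> p = \<zero>\<^bsub>?V\<^esub>} = pol.dim ?A"
    by (intro pol.dim_vectorspace_image polynomials_on finT)
  moreover have "{p \<in> ?A. ?\<phi> p = \<zero>\<^bsub>?V\<^esub>} \<subseteq> {0}"
  proof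
    fix p :: "'k polynomial" assume p: "p \<in> {p \<in> ?A. ?\<phi> p = \<zero>\<^bsub>?V\<^esub>}"
    then have "p \<in> ?\<phi> p" using I.a_rcos_self mem by blast
    then have "p \<in> ?I" using p V(2) by simp
    then have "Poly_Mapping.keys p = {}"
      using p unfolding I_ideal_eq[OF assms] standard_mons_def by blast
    then show "p \<in> {0}" by simp
  qed
  then have "pol.dim {p \<in> ?A. ?\<phi> p = \<zero>\<^bsub>?V\<^esub>} \<le> 0"
    using pol.dim_le_card[of "{p \<in> ?A. ?\<phi> p = \<zero>\<^bsub>?V\<^esub>}" "{}"] by simp
  ultimately show ?thesis
    unfolding hilbert_series_def using polynomials_on(3)[OF finT] by simp
qed

section \<open>Counting monomials and taking differences\<close>

definition num_mons :: "nat \<Rightarrow> int \<Rightarrow> int"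
  where "num_mons k d = int (card (mons k d))"

lemma mons_neg: "d < 0 \<Longrightarrow> mons k d = {}"
  by (auto simp: mons_def)

lemma num_mons_neg: "d < 0 \<Longrightarrow> num_mons k d = 0"
  by (simp add: num_mons_def mons_neg)

lemma num_mons_0: "num_mons 0 d = (if d = 0 then 1 else 0)"
proof -
  have "mons 0 d = (if d = 0 then {0} else {})" by (auto simp: mons_def mon_deg_def)
  then show ?thesis by (simp add: num_mons_def)
qed

text \<open>Multiplication by the monomial \<open>c\<close> is undone by subtracting exponents,
  which is exact wherever \<open>c\<close> divides.\<close>

lemma mons_shift:
  assumes "Poly_Mapping.keys c \<subseteq> {1..k}"
  shows "(\<lambda>m. m + c) ` mons k d =
    {m \<in> mons k (d + int (mon_deg c)). \<forall>j. Poly_Mapping.lookup c j \<le> Poly_Mapping.lookup m j}"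
proof (intro equalityI subsetI)
  fix m assume "m \<in> (\<lambda>m. m + c) ` mons k d"
  then show "m \<in> {m \<in> mons k (d + int (mon_deg c)). \<forall>j. Poly_Mapping.lookup c j \<le> Poly_Mapping.lookup m j}"
    using keys_subset_add[OF _ assms] by (auto simp: mons_def mon_deg_add lookup_add)
next
  fix m assume m: "m \<in> {m \<in> mons k (d + int (mon_deg c)). \<forall>j. Poly_Mapping.lookup c j \<le> Poly_Mapping.lookup m j}"
  then have split: "m = (m - c) + c"
    by (intro poly_mapping_eqI) (simp add: lookup_add lookup_minus)
  have "Poly_Mapping.keys (m - c) \<subseteq> Poly_Mapping.keys m"
    by (auto simp: in_keys_iff lookup_minus)
  moreover have "mon_deg m = mon_deg (m - c) + mon_deg c"
    using arg_cong[OF split, of mon_deg] by (simp only: mon_deg_add)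
  ultimately have "m - c \<in> mons k d" using m by (auto simp: mons_def)
  then show "m \<in> (\<lambda>m. m + c) ` mons k d" using split by (rule rev_image_eqI)
qed

lemma card_mons_shift: "card ((\<lambda>m. m + c) ` mons k d) = card (mons k d)"
  by (rule card_image) (simp add: inj_on_def)

text \<open>Monomials are split according to whether the last variable divides them.\<close>

lemma num_mons_Suc: "num_mons (Suc k) d = num_mons k d + num_mons (Suc k) (d - 1)"
proof -
  let ?c = "Poly_Mapping.single (Suc k) (1::nat)"
  have sh: "(\<lambda>m. m + ?c) ` mons (Suc k) (d - 1) =
      {m \<in> mons (Suc k) d. \<forall>j. Poly_Mapping.lookup ?c j \<le> Poly_Mapping.lookup m j}"
    by (subst mons_shift) auto
  also have "\<dots> = {m \<in> mons (Suc k) d. Suc k \<in> Poly_Mapping.keys m}"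
    by (auto simp: lookup_single when_def in_keys_iff Suc_le_eq)
  finally have sh: "(\<lambda>m. m + ?c) ` mons (Suc k) (d - 1) = {m \<in> mons (Suc k) d. Suc k \<in> Poly_Mapping.keys m}" .
  have "mons (Suc k) d = mons k d \<union> (\<lambda>m. m + ?c) ` mons (Suc k) (d - 1)"
    unfolding sh by (auto simp: mons_def atLeastAtMostSuc_conv)
  moreover have "mons k d \<inter> (\<lambda>m. m + ?c) ` mons (Suc k) (d - 1) = {}"
    unfolding sh by (auto simp: mons_def)
  ultimately have "card (mons (Suc k) d) = card (mons k d) + card ((\<lambda>m. m + ?c) ` mons (Suc k) (d - 1))"
    using card_Un_disjoint[OF finite_mons finite_imageI[OF finite_mons]] by metis
  then show ?thesis by (simp add: num_mons_def card_mons_shift)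
qed

text \<open>Under the recursion of \<open>num_mons_Suc\<close> this is Pascal's rule, by induction
  on \<open>q\<close> and then on the degree.\<close>

lemma num_mons_closed: "num_mons (Suc q) (int k) = int ((k + q) choose q)"
proof (induction q arbitrary: k)
  case 0
  show ?case
  proof (induction k)
    case 0
    show ?case by (simp add: num_mons_Suc[of 0 0] num_mons_0 num_mons_neg)
  next
    case (Suc k)
    have "num_mons (Suc 0) (int (Suc k)) = num_mons 0 (int (Suc k)) + num_mons (Suc 0) (int k)"
      using num_mons_Suc[of 0 "int (Suc k)"] by simp
    then show ?case using Suc by (simp add: num_mons_0)
  qed
next
  case (Suc q)
  note outer = Suc.IH
  show ?case
  proof (induction k)
    case 0
    show ?case using outer[of 0] by (simp add: num_mons_Suc[of "Suc q" 0] num_mons_neg)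
  next
    case (Suc k)
    have "num_mons (Suc (Suc q)) (int (Suc k)) = num_mons (Suc q) (int (Suc k)) + num_mons (Suc (Suc q)) (int k)"
      using num_mons_Suc[of "Suc q" "int (Suc k)"] by simp
    also have "\<dots> = int ((Suc k + q) choose q) + int ((k + Suc q) choose Suc q)"
      using outer[of "Suc k"] Suc by simp
    finally show ?case by simp
  qed
qed

lemma weighted_diff_num_mons: "weighted_diff 1 1 (num_mons (Suc k)) = num_mons k"
proof
  fix i show "weighted_diff 1 1 (num_mons (Suc k)) i = num_mons k i"
    using num_mons_Suc[of k i] by (simp add: weighted_diff_def[of 1 1 "num_mons (Suc k)" i])
qed

text \<open>\<open>num_mons k\<close> has generating series \<open>1 / (1 - T)^k\<close>, and each
  difference cancels one factor.\<close>

lemma weighted_diff_num_mons_pow: "(weighted_diff 1 1 ^^ d) (num_mons (k + d)) = num_mons k"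
  by (induction d) (simp_all add: funpow_swap1 weighted_diff_num_mons)

text \<open>Since \<open>num_mons 0\<close> has generating series 1, these are the coefficients of
  \<open>(1 - T)^d\<close>. The vanishing in negative degrees feeds the induction at
  \<open>k = 0\<close>.\<close>

lemma weighted_diff_num_mons_0:
  "(weighted_diff 1 1 ^^ d) (num_mons 0) (int k) = (- 1) ^ k * int (d choose k)"
  "i < 0 \<Longrightarrow> (weighted_diff 1 1 ^^ d) (num_mons 0) i = 0"
proof (induction d arbitrary: k i)
  case 0
  {
    case 1
    then show ?case by (cases k) (auto simp: num_mons_0)
  next
    case 2
    then show ?case by (simp add: num_mons_0)
  }
next
  case (Suc d)
  {
    case 1
    show ?case
    proof (cases k)
      case 0
      then show ?thesis using Suc.IH(1)[of 0] Suc.IH(2)[of "- 1"] by (simp add: weighted_diff_Suc del: funpow.simps)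
    next
      case (Suc l)
      have "int k - 1 = int l" using Suc by simp
      then have "(weighted_diff 1 1 ^^ Suc d) (num_mons 0) (int k) =
          (- 1) ^ k * int (d choose k) - (- 1) ^ l * int (d choose l)"
        unfolding weighted_diff_Suc using Suc.IH(1)[of k] Suc.IH(1)[of l] by simp
      then show ?thesis by (simp add: Suc algebra_simps)
    qed
  next
    case 2
    then show ?case using Suc.IH(2)[of i] Suc.IH(2)[of "i - 1"] by (simp add: weighted_diff_Suc del: funpow.simps)
  }
qed

text \<open>Inclusion and exclusion: from all monomials remove the multiples of
  \<open>core r\<close>, then restore those multiples that involve only the first
  \<open>r - 1\<close> variables, as they are not in the ideal.\<close>

lemma card_standard_mons:
  assumes "r \<ge> 1" "n \<ge> 1"
  shows "int (card (standard_mons n r i)) =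
    num_mons (n + r - 1) i - num_mons (n + r - 1) (i - int (r - 1)) + num_mons (r - 1) (i - int (r - 1))"
proof -
  let ?N = "n + r - 1" and ?\<rho> = "r - 1"
  let ?i = "i - int ?\<rho>"
  let ?D = "{m \<in> mons ?N i. divisible n r m}"
  have keys_core: "Poly_Mapping.keys (core r) = {1..?\<rho>}"
    by (auto simp: in_keys_iff lookup_core split: if_splits)
  have deg: "mon_deg (core r) = ?\<rho>"
    unfolding mon_deg_def keys_core by (simp add: lookup_core)
  have shift: "(\<lambda>m. m + core r) ` mons k ?i = {m \<in> mons k i. {1..?\<rho>} \<subseteq> Poly_Mapping.keys m}"
    if "?\<rho> \<le> k" for k
  proof -
    have "(\<lambda>m. m + core r) ` mons k ?i =
        {m \<in> mons k i. \<forall>j. Poly_Mapping.lookup (core r) j \<le> Poly_Mapping.lookup m j}"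
      using that keys_core deg by (subst mons_shift) auto
    moreover have "(\<forall>j. Poly_Mapping.lookup (core r) j \<le> Poly_Mapping.lookup m j) \<longleftrightarrow>
        {1..?\<rho>} \<subseteq> Poly_Mapping.keys m" for m
      by (auto simp: lookup_core in_keys_iff subset_iff Suc_le_eq)
    ultimately show ?thesis by simp
  qed
  let ?E = "\<lambda>k. {m \<in> mons k i. {1..?\<rho>} \<subseteq> Poly_Mapping.keys m}"
  have cardE: "int (card (?E k)) = num_mons k ?i" if "?\<rho> \<le> k" for k
    unfolding shift[OF that, symmetric] card_mons_shift num_mons_def ..
  have E: "?E ?N = ?D \<union> ?E ?\<rho>" "?D \<inter> ?E ?\<rho> = {}"
  proof -
    have split: "{1..?N} = {1..?\<rho>} \<union> {r..n + r - 1}" using assms by auto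
    show "?E ?N = ?D \<union> ?E ?\<rho>"
      unfolding mons_def divisible_def split by blast
    have "m \<notin> ?E ?\<rho>" if D: "m \<in> ?D" for m
    proof
      assume "m \<in> ?E ?\<rho>"
      then have "Poly_Mapping.keys m \<subseteq> {1..?\<rho>}" by (simp add: mons_def)
      moreover obtain j where "j \<in> {r..n + r - 1}" "j \<in> Poly_Mapping.keys m"
        using D unfolding divisible_def by blast
      ultimately show False using assms by auto
    qed
    then show "?D \<inter> ?E ?\<rho> = {}" by blast
  qed
  have fin: "finite ?D" "finite (?E ?\<rho>)" using finite_mons by auto
  have "card (?E ?N) = card ?D + card (?E ?\<rho>)"
    unfolding E(1) by (rule card_Un_disjoint[OF fin E(2)])
  from arg_cong[OF this, of int]
  have "int (card (?E ?N)) = int (card ?D) + int (card (?E ?\<rho>))" by simp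
  moreover have "?\<rho> \<le> ?N" using assms by simp
  ultimately have "num_mons ?N ?i = int (card ?D) + num_mons ?\<rho> ?i"
    using cardE[of ?N] cardE[of ?\<rho>] by linarith
  moreover have "card (mons ?N i) = card (standard_mons n r i) + card ?D"
  proof -
    have "mons ?N i = standard_mons n r i \<union> ?D" "standard_mons n r i \<inter> ?D = {}"
      by (auto simp: standard_mons_def)
    moreover have "finite (standard_mons n r i)" using finite_mons by (simp add: standard_mons_def)
    ultimately show ?thesis using card_Un_disjoint[of "standard_mons n r i" ?D] fin(1) by argo
  qed
  then have "num_mons ?N i = int (card (standard_mons n r i)) + int (card ?D)"
    by (simp add: num_mons_def)
  ultimately show ?thesis by linarith
qed

section \<open>A negative coefficient\<close>

lemma weighted_diff_pow_linear:
  "(weighted_diff 1 1 ^^ d) (\<lambda>i. f i - g (i - a) + h (i - a)) i =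
    (weighted_diff 1 1 ^^ d) f i - (weighted_diff 1 1 ^^ d) g (i - a) + (weighted_diff 1 1 ^^ d) h (i - a)"
  for f g h :: "int \<Rightarrow> int"
proof (induction d arbitrary: i)
  case (Suc d)
  have e: "i - 1 - a = i - a - 1" by simp
  show ?case unfolding weighted_diff_Suc Suc.IH e by simp
qed simp

text \<open>With \<open>d = n + r - 2 - q\<close>, multiplying the Hilbert series by
  \<open>(1 - T)^d\<close> gives
  \<open>(1 - T^(r-1)) / (1 - T)^(q+1) + T^(r-1) (1 - T)^(n-1-q)\<close>, whose coefficients are
  read off.\<close>

lemma difference_standard_mons:
  assumes "n > r" "r \<ge> 2" "3 * q + r + 1 \<le> n"
  shows "(weighted_diff 1 1 ^^ (n + r - 2 - q)) (\<lambda>i. int (card (standard_mons n r i))) (int (r - 1 + k)) =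
    int ((r - 1 + k + q) choose q) - int ((k + q) choose q) + (- 1) ^ k * int ((n - 1 - q) choose k)"
proof -
  let ?d = "n + r - 2 - q" and ?i = "int (r - 1 + k)"
  have i: "?i - int (r - 1) = int k" by simp
  have N: "n + r - 1 = Suc q + ?d" and d: "?d = (n - 1 - q) + (r - 1)" using assms by auto
  have top: "(weighted_diff 1 1 ^^ ?d) (num_mons (n + r - 1)) = num_mons (Suc q)"
    unfolding N by (rule weighted_diff_num_mons_pow)
  have "(weighted_diff 1 1 ^^ ?d) (num_mons (r - 1)) = (weighted_diff 1 1 ^^ (n - 1 - q)) ((weighted_diff 1 1 ^^ (r - 1)) (num_mons (0 + (r - 1))))"
    unfolding d funpow_add by simp
  also have "\<dots> = (weighted_diff 1 1 ^^ (n - 1 - q)) (num_mons 0)"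
    by (simp only: weighted_diff_num_mons_pow)
  finally have bot: "(weighted_diff 1 1 ^^ ?d) (num_mons (r - 1)) = (weighted_diff 1 1 ^^ (n - 1 - q)) (num_mons 0)" .
  have "(\<lambda>i. int (card (standard_mons n r i))) = (\<lambda>i. num_mons (n + r - 1) i
      - num_mons (n + r - 1) (i - int (r - 1)) + num_mons (r - 1) (i - int (r - 1)))"
    using assms by (intro ext card_standard_mons) auto
  then show ?thesis
    by (simp only: weighted_diff_pow_linear top bot i num_mons_closed weighted_diff_num_mons_0(1))
qed

lemma difference_standard_mons_neg:
  assumes "n > r" "r \<ge> 2" "3 * q + r + 1 \<le> n"
  shows "\<exists>i. (weighted_diff 1 1 ^^ (n + r - 2 - q)) (\<lambda>i. int (card (standard_mons n r i))) i < 0"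
proof -
  define k where "k = (if odd q then q else q + 1)"
  have "odd k" by (simp add: k_def)
  have "(r - 1 + k + q) choose q \<le> (r + 2 * q) choose q"
    \<comment> \<open>Here \<open>k \<le> q + 1\<close> is used.\<close>
    using assms(2) by (intro binomial_right_mono) (auto simp: k_def)
  \<comment> \<open>As \<open>r \<ge> 2\<close>, both \<open>q\<close> and \<open>k\<close> lie in
    the increasing half of row \<open>r + 2 * q\<close>.\<close>
  also have "\<dots> \<le> (r + 2 * q) choose k"
    using assms(2) by (intro binomial_mono) (auto simp: k_def)
  \<comment> \<open>This is where the size of \<open>q\<close> enters:
    \<open>r + 2 * q \<le> n - 1 - q\<close> is the hypothesis
    \<open>3 * q + r + 1 \<le> n\<close>.\<close>
  also have "\<dots> \<le> (n - 1 - q) choose k"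
    using assms(3) by (intro binomial_right_mono) auto
  finally have "int ((r - 1 + k + q) choose q) \<le> int ((n - 1 - q) choose k)" by simp
  \<comment> \<open>This middle term makes the inequality strict.\<close>
  moreover have "0 < int ((k + q) choose q)" by simp
  moreover have sign: "(- 1) ^ k = (- 1 :: int)" using \<open>odd k\<close> by simp
  ultimately have "int ((r - 1 + k + q) choose q) - int ((k + q) choose q) + (- 1) ^ k * int ((n - 1 - q) choose k) < 0"
    unfolding sign by linarith
  then show ?thesis by (intro exI) (subst difference_standard_mons[OF assms])
qed

theorem theorem2p8:
  fixes n r :: nat
  assumes "n > r" and "r \<ge> 2"
  shows "hdepth (n + r - 1) (quotient_module (n + r - 1) (I_ideal n r :: 'k::field polynomial set))
      \<le> enat (n + r - (n - r - 1) div 3 - 3)"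
proof -
  let ?N = "n + r - 1"
  let ?M = "quotient_module ?N (I_ideal n r :: 'k polynomial set)"
  define q where "q = (n - r - 1) div 3"
  have q: "3 * q + r + 1 \<le> n" using assms(1) by (simp add: q_def)
  have bound: "length fs \<le> n + r - q - 3"
    if U: "is_graded_module ?N U" "finitely_generated ?N U" "hilbert_series U = hilbert_series ?M"
      and fs: "set fs \<subseteq> irrelevant_ideal ?N" "regular_sequence ?N U fs"
    for U :: "('k polynomial, nat \<Rightarrow> 'k) graded_module" and fs
  proof (rule ccontr)
    assume "\<not> length fs \<le> n + r - q - 3"
    \<comment> \<open>A violating sequence has at least one element more than the bound, which is
      the order of the difference that takes a negative value.\<close>
    then have "n + r - 2 - q \<le> length fs" using assms q by linarith
    then have "0 \<le> (weighted_diff 1 1 ^^ (n + r - 2 - q)) (\<lambda>i. int (hilbert_series U i)) i" for i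
      using regular_sequence_difference_nonneg[OF _ U(1,2) fs] assms by simp
    moreover have "hilbert_series U i = card (standard_mons n r i)" for i
      using hilbert_series_quotient[of r n i, where ?'k = 'k] assms(2) by (simp add: U(3))
    ultimately show False
      using difference_standard_mons_neg[OF assms q] by (simp add: not_le[symmetric])
  qed
  show ?thesis
    unfolding hdepth_def q_def[symmetric]
  proof (rule Sup_least)
    fix x assume "x \<in> {depth ?N U | U :: ('k polynomial, nat \<Rightarrow> 'k) graded_module.
      is_graded_module ?N U \<and> finitely_generated ?N U \<and> hilbert_series U = hilbert_series ?M}"
    then obtain U :: "('k polynomial, nat \<Rightarrow> 'k) graded_module" where x: "x = depth ?N U"
      and U: "is_graded_module ?N U" "finitely_generated ?N U" "hilbert_series U = hilbert_series ?M"
      by blast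
    show "x \<le> enat (n + r - q - 3)"
      unfolding x depth_def
    proof (rule Sup_least)
      fix y assume "y \<in> {enat (length fs) | fs. set fs \<subseteq> irrelevant_ideal ?N \<and> regular_sequence ?N U fs}"
      then obtain fs where y: "y = enat (length fs)"
        and fs: "set fs \<subseteq> irrelevant_ideal ?N" "regular_sequence ?N U fs"
        by blast
      show "y \<le> enat (n + r - q - 3)"
        unfolding y enat_ord_simps by (rule bound[OF U fs])
    qed
  qed
qed

end
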